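(* Let $G$ be a second-countable, non-precompact, amenable topological group. Then there exists a sequence of $G^n$-left-invariant means $\mu_n\in\mathrm{M}(G^n)$ $(n\in\mathbb{N}_{>0})$ such that, for every right-invariant metric $d$ on $G$ generating the topology of $G$, there exists a function $f\colon G\to[0,1]$ with $|f(x)-f(y)|\le d(x,y)$ for all $x,y\in G$ and $$\inf_{n\in\mathbb{N}_{>0}}\mu_n\Bigl(\bigl(f_{n,n}-\mu_n(f_{n,n})\bigr)^2\Bigr)>0,$$ where $f_{n,n}\colon G^n\to\mathbb{R}$, $x\mapsto\frac1n\sum_{j=1}^nf(x_j)$.
   Context: For a topological group $G$ and $g\in G$ let $\lambda_g\colon G\to G$, $x\mapsto gx$. $\mathrm{RUCB}(G)$ is the unital real Banach algebra of all bounded functions $f\colon G\to\mathbb{R}$ such that for every $\epsilon>0$ there is a neighborhood $U$ of $e$ with $\|f-f\circ\lambda_g\|_\infty\le\epsilon$ for all $g\in U$. $\mathrm{M}(G)$ is the set of means, i.e., positive unital linear functionals on $\mathrm{RUCB}(G)$. A mean $\mu\in\mathrm{M}(G)$ is $G$-left-invariant if $\mu(f\circ\lambda_g)=\mu(f)$ for all $f\in\mathrm{RUCB}(G)$, $g\in G$; $G$ is amenable if such a mean exists. $G$ is precompact if for every neighborhood $U$ of $e$ there is a finite $F\subseteq G$ with $G=UF$. $G^n$ carries the product topology and coordinatewise group structure, and these notions are applied to $G^n$ too. A metric $d$ on $G$ is right-invariant if $d(xg,yg)=d(x,y)$ for all $g,x,y\in G$. *)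

theory Defs
  imports "HOL-Analysis.Analysis" "HOL-Algebra.Product_Groups"
begin

text \<open>
  A topological group is a carrier-based group together with an abstract topology on its carrier.
  No separation axiom is assumed.
\<close>

locale topological_group = group G
  for G :: "('a, 'b) monoid_scheme" (structure) and T :: "'a topology" +
  assumes topspace_eq: "topspace T = carrier G"
    and continuous_mult: "continuous_map (prod_topology T T) T (\<lambda>(x, y). x \<otimes> y)"
    and continuous_inv: "continuous_map T T (\<lambda>x. inv x)"

text \<open>The powers of a topological group; coordinates are indexed by \<open>1, \<dots>, n\<close>.\<close>

definition group_power :: "('a, 'b) monoid_scheme \<Rightarrow> nat \<Rightarrow> (nat \<Rightarrow> 'a) monoid" where
  "group_power G n = product_group {1..n} (\<lambda>_. G)"

definition topology_power :: "'a topology \<Rightarrow> nat \<Rightarrow> (nat \<Rightarrow> 'a) topology" where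
  "topology_power T n = product_topology (\<lambda>_. T) {1..n}"

text \<open>Neighborhoods are not required to be open.\<close>

definition neighborhood :: "'a topology \<Rightarrow> 'a \<Rightarrow> 'a set \<Rightarrow> bool" where
  "neighborhood T x U \<longleftrightarrow> U \<subseteq> topspace T \<and> (\<exists>V. openin T V \<and> x \<in> V \<and> V \<subseteq> U)"

definition precompact_group :: "('a, 'b) monoid_scheme \<Rightarrow> 'a topology \<Rightarrow> bool" where
  "precompact_group G T \<longleftrightarrow>
     (\<forall>U. neighborhood T \<one>\<^bsub>G\<^esub> U \<longrightarrow>
        (\<exists>F. finite F \<and> F \<subseteq> carrier G \<and> carrier G = U <#>\<^bsub>G\<^esub> F))"

text \<open>
  Real functions on the group are represented as extensional functions on the carrier, so that
  equality in HOL is equality of functions on the group.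
\<close>

definition left_translate ::
  "('a, 'b) monoid_scheme \<Rightarrow> 'a \<Rightarrow> ('a \<Rightarrow> real) \<Rightarrow> 'a \<Rightarrow> real" where
  "left_translate G g f = (\<lambda>x\<in>carrier G. f (g \<otimes>\<^bsub>G\<^esub> x))"

text \<open>Only meaningful for functions that are bounded on a nonempty set \<open>A\<close>.\<close>

definition sup_norm :: "'a set \<Rightarrow> ('a \<Rightarrow> real) \<Rightarrow> real" where
  "sup_norm A f = (SUP x\<in>A. \<bar>f x\<bar>)"

definition RUCB :: "('a, 'b) monoid_scheme \<Rightarrow> 'a topology \<Rightarrow> ('a \<Rightarrow> real) set" where
  "RUCB G T = {f \<in> carrier G \<rightarrow>\<^sub>E UNIV. bounded (f ` carrier G) \<and>
     (\<forall>\<epsilon>>0. \<exists>U. neighborhood T \<one>\<^bsub>G\<^esub> U \<and>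
        (\<forall>g\<in>U. sup_norm (carrier G) (\<lambda>x. f x - left_translate G g f x) \<le> \<epsilon>))}"

text \<open>
  Only the values of a functional on \<^term>\<open>RUCB G T\<close> are relevant; its values elsewhere are
  unconstrained.
\<close>

definition means ::
  "('a, 'b) monoid_scheme \<Rightarrow> 'a topology \<Rightarrow> (('a \<Rightarrow> real) \<Rightarrow> real) set" where
  "means G T = {\<mu>.
     (\<forall>f\<in>RUCB G T. \<forall>h\<in>RUCB G T. \<mu> (\<lambda>x\<in>carrier G. f x + h x) = \<mu> f + \<mu> h) \<and>
     (\<forall>f\<in>RUCB G T. \<forall>c. \<mu> (\<lambda>x\<in>carrier G. c * f x) = c * \<mu> f) \<and>
     (\<forall>f\<in>RUCB G T. (\<forall>x\<in>carrier G. 0 \<le> f x) \<longrightarrow> 0 \<le> \<mu> f) \<and>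
     \<mu> (\<lambda>x\<in>carrier G. 1) = 1}"

definition left_invariant_mean ::
  "('a, 'b) monoid_scheme \<Rightarrow> 'a topology \<Rightarrow> (('a \<Rightarrow> real) \<Rightarrow> real) \<Rightarrow> bool" where
  "left_invariant_mean G T \<mu> \<longleftrightarrow> \<mu> \<in> means G T \<and>
     (\<forall>f\<in>RUCB G T. \<forall>g\<in>carrier G. \<mu> (left_translate G g f) = \<mu> f)"

definition amenable_group :: "('a, 'b) monoid_scheme \<Rightarrow> 'a topology \<Rightarrow> bool" where
  "amenable_group G T \<longleftrightarrow> (\<exists>\<mu>. left_invariant_mean G T \<mu>)"

definition right_invariant :: "('a, 'b) monoid_scheme \<Rightarrow> ('a \<Rightarrow> 'a \<Rightarrow> real) \<Rightarrow> bool" where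
  "right_invariant G d \<longleftrightarrow>
     (\<forall>g\<in>carrier G. \<forall>x\<in>carrier G. \<forall>y\<in>carrier G. d (x \<otimes>\<^bsub>G\<^esub> g) (y \<otimes>\<^bsub>G\<^esub> g) = d x y)"

text \<open>The function written \<open>f\<^sub>n\<^sub>,\<^sub>n\<close> in the literature.\<close>

definition coordinate_average ::
  "('a, 'b) monoid_scheme \<Rightarrow> nat \<Rightarrow> ('a \<Rightarrow> real) \<Rightarrow> (nat \<Rightarrow> 'a) \<Rightarrow> real" where
  "coordinate_average G n f =
     (\<lambda>x\<in>carrier (group_power G n). (1 / real n) * (\<Sum>j=1..n. f (x j)))"

definition mean_variance ::
  "('a, 'b) monoid_scheme \<Rightarrow> (('a \<Rightarrow> real) \<Rightarrow> real) \<Rightarrow> ('a \<Rightarrow> real) \<Rightarrow> real" where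
  "mean_variance G \<mu> f = \<mu> (\<lambda>x\<in>carrier G. (f x - \<mu> f)\<^sup>2)"

end

(*
  If alpha and beta are left-invariant means on G with alpha f < beta f, then the average of their
  n-fold iterated integrals is a left-invariant mean on G^n under which f_{n,n} has variance at
  least (alpha f - beta f)^2 / 4, uniformly in n: both iterated integrals have f as marginal in
  every coordinate.

  To obtain alpha and beta independently of the metric, right-translate one invariant mean nu along
  the even and the odd terms of a sequence w in G, taking generalized limits inside nu.
  Non-precompactness and amenability allow w to be chosen such that, for a dense sequence q, the
  points q_i w_k with i <= k are uniformly separated for distinct k. The distance to the set of those with k even then
  has mean 0 under alpha and positive mean under beta. Two right-invariant metrics generating the
  same topology are uniformly equivalent, so this works simultaneously for all metrics.
*)

theory Submission
  imports Defs
begin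

section \<open>Means on right uniformly continuous functions\<close>

text \<open>One invariant mean does not suffice: under the n-fold iterated integral of a single
  mean, distinct coordinates are uncorrelated, so the variance of f_{n,n} is at most 1/n. A mixture
  of two such integrals keeps the gap between their two expectations, which averaging over
  coordinates does not shrink.

  The generalized limit has to be taken inside nu because the bounds on
  \<open>f (x \<otimes> w k)\<close> hold only from some k on, and this k depends on the point x. At
  no single k do they hold for all x, so limits of the numbers obtained by applying nu to individual
  right translates would not be controlled.

  The difficulty in choosing w is that the next term y must avoid finitely many sets a^{-1} B c,
  with B a ball around the identity, while non-precompactness speaks only of sets B c. An invariant
  mean does not see the left factor a^{-1}, and this is how amenability enters beyond supplying
  nu.\<close>

text \<open>By Tychonoff, the evaluations of a sequence at k have a cluster point \<open>L\<close>
  in a product of compact intervals. It inherits every closed condition that the evaluations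
  eventually satisfy. Upper bounds follow from lower ones by homogeneity with the factor -1.\<close>

lemma generalized_limit_exists:
  obtains L :: "(nat \<Rightarrow> real) \<Rightarrow> real"
  where "\<And>u v. bounded (range u) \<Longrightarrow> bounded (range v) \<Longrightarrow> L (\<lambda>k. u k + v k) = L u + L v"
    and "\<And>u c. bounded (range u) \<Longrightarrow> L (\<lambda>k. c * u k) = c * L u"
    and "\<And>u c. bounded (range u) \<Longrightarrow> eventually (\<lambda>k. c \<le> u k) sequentially \<Longrightarrow> c \<le> L u"
proof -
  \<comment> \<open>The value 0 on unbounded sequences confines every coordinate of
    \<open>e k\<close> to an interval independent of k, so that all \<open>e k\<close> lie in the
    compact set \<open>K\<close>.\<close>
  define e :: "nat \<Rightarrow> (nat \<Rightarrow> real) \<Rightarrow> real"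
    where "e k u = (if bounded (range u) then u k else 0)" for k u
  have "\<exists>B. \<forall>k. \<bar>e k u\<bar> \<le> B" for u
  proof (cases "bounded (range u)")
    case True
    then show ?thesis by (auto simp: e_def bounded_iff)
  next
    case False
    then show ?thesis by (intro exI[of _ 0]) (simp add: e_def)
  qed
  then obtain B where B: "\<And>u k. \<bar>e k u\<bar> \<le> B u"
    by metis
  define K where "K = (\<Pi>\<^sub>E u\<in>UNIV. {- B u..B u})"
  have "compact K"
    using compactin_PiE[of "\<lambda>_. euclidean" UNIV "\<lambda>u. {- B u..B u}"]
    by (simp add: K_def euclidean_product_topology)
  moreover have "eventually (\<lambda>z. z \<in> K) (filtermap e sequentially)"
    using B by (auto simp: K_def eventually_filtermap abs_le_iff minus_le_iff PiE_def extensional_def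
        intro!: always_eventually)
  moreover have "filtermap e sequentially \<noteq> bot"
    by (simp add: filtermap_bot_iff)
  ultimately obtain L where L: "inf (nhds L) (filtermap e sequentially) \<noteq> bot"
    unfolding compact_filter by blast
  have mem: "L \<in> S" if "closed S" "eventually (\<lambda>k. e k \<in> S) sequentially" for S
  proof (rule ccontr)
    assume "L \<notin> S"
    then have "eventually (\<lambda>z. z \<in> - S) (nhds L)"
      using that(1) by (intro eventually_nhds_in_open) auto
    then have "eventually (\<lambda>_. False) (inf (nhds L) (filtermap e sequentially))"
      using that(2) unfolding eventually_inf eventually_filtermap
      by (intro exI[of _ "\<lambda>z. z \<in> - S"] exI[of _ "\<lambda>z. z \<in> S"]) simp
    then show False
      using L by (simp add: trivial_limit_def)
  qed
  have cont: "continuous_on UNIV (\<lambda>z :: (nat \<Rightarrow> real) \<Rightarrow> real. z u)" for u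
    by simp
  show thesis
  proof
    fix u v :: "nat \<Rightarrow> real" and c :: real
    assume u: "bounded (range u)"
    {
      assume v: "bounded (range v)"
      have "bounded (range (\<lambda>k. u k + v k))"
        using u v by (rule bounded_plus_comp)
      then have "e k \<in> {z. z (\<lambda>k. u k + v k) = z u + z v}" for k
        using u v by (simp add: e_def)
      moreover have "closed {z :: (nat \<Rightarrow> real) \<Rightarrow> real. z (\<lambda>k. u k + v k) = z u + z v}"
        by (intro closed_Collect_eq continuous_intros cont)
      ultimately show "L (\<lambda>k. u k + v k) = L u + L v"
        using mem by fastforce
    }
    {
      have "bounded (range (\<lambda>k. c * u k))"
        using bounded_scaling[OF u, of c] by (simp add: image_comp o_def)
      then have "e k \<in> {z. z (\<lambda>k. c * u k) = c * z u}" for k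
        using u by (simp add: e_def)
      moreover have "closed {z :: (nat \<Rightarrow> real) \<Rightarrow> real. z (\<lambda>k. c * u k) = c * z u}"
        by (intro closed_Collect_eq continuous_intros cont)
      ultimately show "L (\<lambda>k. c * u k) = c * L u"
        using mem by fastforce
    }
    {
      assume "eventually (\<lambda>k. c \<le> u k) sequentially"
      then have "eventually (\<lambda>k. e k \<in> {z. c \<le> z u}) sequentially"
        using u by (simp add: e_def)
      moreover have "closed {z :: (nat \<Rightarrow> real) \<Rightarrow> real. c \<le> z u}"
        by (intro closed_Collect_le continuous_intros cont)
      ultimately show "c \<le> L u"
        using mem by fastforce
    }
  qed
qed

section \<open>Right uniformly continuous bounded functions\<close>

text \<open>All powers of G satisfy these weak axioms without any continuity argument in product
  topologies, so the facts about means apply to them directly. \<open>limit_mean_exists\<close>,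
  which does need continuity of right translations, takes it as a hypothesis.\<close>

locale topologized_group = group G
  for G :: "('a, 'b) monoid_scheme" (structure) and T :: "'a topology" +
  assumes topspace_eq: "topspace T = carrier G"
begin

text \<open>The supremum in \<open>sup_norm\<close> is faithful only for bounded functions, whence
  the case distinction: for bounded f it unfolds to a pointwise bound, and unbounded f belong to
  neither side. Neighborhoods can be shrunk to open ones.\<close>

lemma RUCB_iff:
  "f \<in> RUCB G T \<longleftrightarrow> f \<in> extensional (carrier G) \<and> bounded (f ` carrier G) \<and>
     (\<forall>\<epsilon>>0. \<exists>V. openin T V \<and> \<one> \<in> V \<and> (\<forall>g\<in>V. \<forall>x\<in>carrier G. \<bar>f x - f (g \<otimes> x)\<bar> \<le> \<epsilon>))"
proof -
  have sup_norm_le: "sup_norm (carrier G) (\<lambda>x. f x - left_translate G g f x) \<le> \<epsilon> \<longleftrightarrow>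
      (\<forall>x\<in>carrier G. \<bar>f x - f (g \<otimes> x)\<bar> \<le> \<epsilon>)"
    if f: "bounded (f ` carrier G)" and g: "g \<in> carrier G" for \<epsilon> g
  proof -
    obtain B where B: "\<And>x. x \<in> carrier G \<Longrightarrow> \<bar>f x\<bar> \<le> B"
      using f by (auto simp: bounded_iff)
    have "\<bar>f x - left_translate G g f x\<bar> \<le> B + B" if "x \<in> carrier G" for x
      using B[of x] B[of "g \<otimes> x"] that g by (simp add: left_translate_def)
    then have "bdd_above ((\<lambda>x. \<bar>f x - left_translate G g f x\<bar>) ` carrier G)"
      by (meson bdd_aboveI2)
    then show ?thesis
      unfolding sup_norm_def
      by (subst cSUP_le_iff) (auto simp: left_translate_def)
  qed
  have nbhd: "(\<exists>U. neighborhood T \<one> U \<and> (\<forall>g\<in>U. P g)) \<longleftrightarrow> (\<exists>V. openin T V \<and> \<one> \<in> V \<and> (\<forall>g\<in>V. P g))"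
    for P
    unfolding neighborhood_def by (metis openin_subset order_refl subsetD)
  have sub: "openin T V \<Longrightarrow> g \<in> V \<Longrightarrow> g \<in> carrier G" for V g
    using openin_subset topspace_eq by blast
  show ?thesis
  proof (cases "bounded (f ` carrier G)")
    case True
    have "(openin T V \<and> \<one> \<in> V \<and>
          (\<forall>g\<in>V. sup_norm (carrier G) (\<lambda>x. f x - left_translate G g f x) \<le> \<epsilon>)) \<longleftrightarrow>
        (openin T V \<and> \<one> \<in> V \<and> (\<forall>g\<in>V. \<forall>x\<in>carrier G. \<bar>f x - f (g \<otimes> x)\<bar> \<le> \<epsilon>))" for V \<epsilon>
      using sup_norm_le[OF True] sub by blast
    then show ?thesis
      unfolding RUCB_def nbhd using True by (simp add: PiE_def)
  qed (simp add: RUCB_def)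
qed

lemma RUCB_I:
  assumes "f \<in> extensional (carrier G)"
    and "\<And>x. x \<in> carrier G \<Longrightarrow> \<bar>f x\<bar> \<le> B"
    and "\<And>\<epsilon>. \<epsilon> > 0 \<Longrightarrow> \<exists>V. openin T V \<and> \<one> \<in> V \<and> (\<forall>g\<in>V. \<forall>x\<in>carrier G. \<bar>f x - f (g \<otimes> x)\<bar> \<le> \<epsilon>)"
  shows "f \<in> RUCB G T"
proof -
  have "bounded (f ` carrier G)"
    using assms(2) unfolding bounded_iff by auto
  with assms(1,3) show ?thesis
    unfolding RUCB_iff by blast
qed

lemma RUCB_extensional: "f \<in> RUCB G T \<Longrightarrow> f \<in> extensional (carrier G)"
  by (simp add: RUCB_iff)

lemma RUCB_bound:
  assumes "f \<in> RUCB G T"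
  obtains B where "B \<ge> 0" "\<And>x. x \<in> carrier G \<Longrightarrow> \<bar>f x\<bar> \<le> B"
proof -
  from assms have "bounded (f ` carrier G)"
    by (simp add: RUCB_iff)
  then obtain B where B: "\<And>x. x \<in> carrier G \<Longrightarrow> \<bar>f x\<bar> \<le> B"
    by (auto simp: bounded_iff)
  have "B \<ge> 0"
    by (rule order_trans[OF abs_ge_zero B[OF one_closed]])
  from that[OF this B] show thesis .
qed

lemma RUCB_unif:
  assumes "f \<in> RUCB G T" "\<epsilon> > 0"
  obtains V where "openin T V" "\<one> \<in> V" "V \<subseteq> carrier G"
    "\<And>g x. g \<in> V \<Longrightarrow> x \<in> carrier G \<Longrightarrow> \<bar>f x - f (g \<otimes> x)\<bar> \<le> \<epsilon>"
proof -
  from assms obtain V where V: "openin T V" "\<one> \<in> V"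
    "\<forall>g\<in>V. \<forall>x\<in>carrier G. \<bar>f x - f (g \<otimes> x)\<bar> \<le> \<epsilon>"
    unfolding RUCB_iff by meson
  have "V \<subseteq> carrier G"
    using openin_subset[OF V(1)] by (simp only: topspace_eq)
  from that[OF V(1,2) this] V(3) show thesis by blast
qed

lemma RUCB_const: "(\<lambda>x\<in>carrier G. c) \<in> RUCB G T"
proof (rule RUCB_I)
  show "\<exists>V. openin T V \<and> \<one> \<in> V \<and>
    (\<forall>g\<in>V. \<forall>x\<in>carrier G. \<bar>(\<lambda>x\<in>carrier G. c) x - (\<lambda>x\<in>carrier G. c) (g \<otimes> x)\<bar> \<le> \<epsilon>)"
    if "\<epsilon> > 0" for \<epsilon> :: real
    using that openin_topspace[of T] by (intro exI[of _ "topspace T"]) (auto simp: topspace_eq)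
qed auto

text \<open>A locally Lipschitz F has one Lipschitz constant on a square containing all pairs of
  values of f and h, so it transports their uniform moduli. Sums, multiples and squares are
  instances.\<close>

lemma RUCB_combine:
  fixes F :: "real \<Rightarrow> real \<Rightarrow> real"
  assumes f: "f \<in> RUCB G T" and h: "h \<in> RUCB G T"
    and F: "\<And>B. B \<ge> 0 \<Longrightarrow> \<exists>C. \<forall>s t s' t'. \<bar>s\<bar> \<le> B \<longrightarrow> \<bar>t\<bar> \<le> B \<longrightarrow> \<bar>s'\<bar> \<le> B \<longrightarrow> \<bar>t'\<bar> \<le> B \<longrightarrow>
              \<bar>F s t - F s' t'\<bar> \<le> C * (\<bar>s - s'\<bar> + \<bar>t - t'\<bar>)"
  shows "(\<lambda>x\<in>carrier G. F (f x) (h x)) \<in> RUCB G T"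
proof -
  obtain B1 where "B1 \<ge> 0" and B1: "\<And>x. x \<in> carrier G \<Longrightarrow> \<bar>f x\<bar> \<le> B1"
    using RUCB_bound[OF f] by blast
  obtain B2 where "B2 \<ge> 0" and B2: "\<And>x. x \<in> carrier G \<Longrightarrow> \<bar>h x\<bar> \<le> B2"
    using RUCB_bound[OF h] by blast
  define B where "B = B1 + B2"
  have "B \<ge> 0" and B: "\<And>x. x \<in> carrier G \<Longrightarrow> \<bar>f x\<bar> \<le> B" "\<And>x. x \<in> carrier G \<Longrightarrow> \<bar>h x\<bar> \<le> B"
    using \<open>B1 \<ge> 0\<close> \<open>B2 \<ge> 0\<close> B1 B2 by (force simp: B_def)+
  obtain C' where C': "\<And>s t s' t'. \<bar>s\<bar> \<le> B \<Longrightarrow> \<bar>t\<bar> \<le> B \<Longrightarrow> \<bar>s'\<bar> \<le> B \<Longrightarrow> \<bar>t'\<bar> \<le> B \<Longrightarrow>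
              \<bar>F s t - F s' t'\<bar> \<le> C' * (\<bar>s - s'\<bar> + \<bar>t - t'\<bar>)"
    using F[OF \<open>B \<ge> 0\<close>] by blast
  \<comment> \<open>The added 1 makes the constant positive, so that
    \<open>\<epsilon> / (2 * C)\<close> is an admissible tolerance for f and h.\<close>
  define C where "C = \<bar>C'\<bar> + 1"
  have "C > 0" "C' \<le> C" by (auto simp: C_def)
  have C: "\<bar>F s t - F s' t'\<bar> \<le> C * (\<bar>s - s'\<bar> + \<bar>t - t'\<bar>)"
    if "\<bar>s\<bar> \<le> B" "\<bar>t\<bar> \<le> B" "\<bar>s'\<bar> \<le> B" "\<bar>t'\<bar> \<le> B" for s t s' t'
    using C'[OF that] mult_right_mono[OF \<open>C' \<le> C\<close>, of "\<bar>s - s'\<bar> + \<bar>t - t'\<bar>"] by simp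
  show ?thesis
  proof (rule RUCB_I)
    show "\<bar>(\<lambda>x\<in>carrier G. F (f x) (h x)) x\<bar> \<le> \<bar>F 0 0\<bar> + C * (B + B)" if "x \<in> carrier G" for x
    proof -
      have "\<bar>F (f x) (h x) - F 0 0\<bar> \<le> C * (\<bar>f x\<bar> + \<bar>h x\<bar>)"
        using C[of "f x" "h x" 0 0] B that \<open>B \<ge> 0\<close> by simp
      also have "\<dots> \<le> C * (B + B)"
        using \<open>C > 0\<close> B that by (intro mult_left_mono add_mono) auto
      finally show ?thesis using that by simp
    qed
  next
    fix \<epsilon> :: real
    assume "\<epsilon> > 0"
    then have pos: "\<epsilon> / (2 * C) > 0" using \<open>C > 0\<close> by simp
    obtain V where V: "openin T V" "\<one> \<in> V" "V \<subseteq> carrier G"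
      "\<And>g x. g \<in> V \<Longrightarrow> x \<in> carrier G \<Longrightarrow> \<bar>f x - f (g \<otimes> x)\<bar> \<le> \<epsilon> / (2 * C)"
      using RUCB_unif[OF f pos] by metis
    obtain W where W: "openin T W" "\<one> \<in> W"
      "\<And>g x. g \<in> W \<Longrightarrow> x \<in> carrier G \<Longrightarrow> \<bar>h x - h (g \<otimes> x)\<bar> \<le> \<epsilon> / (2 * C)"
      using RUCB_unif[OF h pos] by metis
    show "\<exists>V. openin T V \<and> \<one> \<in> V \<and> (\<forall>g\<in>V. \<forall>x\<in>carrier G.
       \<bar>(\<lambda>x\<in>carrier G. F (f x) (h x)) x - (\<lambda>x\<in>carrier G. F (f x) (h x)) (g \<otimes> x)\<bar> \<le> \<epsilon>)"
    proof (intro exI[of _ "V \<inter> W"] conjI ballI)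
      fix g x
      assume g: "g \<in> V \<inter> W" and x: "x \<in> carrier G"
      then have gx: "g \<otimes> x \<in> carrier G" using V(3) by auto
      have "\<bar>F (f x) (h x) - F (f (g \<otimes> x)) (h (g \<otimes> x))\<bar> \<le>
          C * (\<bar>f x - f (g \<otimes> x)\<bar> + \<bar>h x - h (g \<otimes> x)\<bar>)"
        using C B x gx by simp
      also have "\<dots> \<le> C * (\<epsilon> / (2 * C) + \<epsilon> / (2 * C))"
        using \<open>C > 0\<close> V(4) W(3) g x by (intro mult_left_mono add_mono) auto
      also have "\<dots> = \<epsilon>" using \<open>C > 0\<close> by simp
      finally show "\<bar>(\<lambda>x\<in>carrier G. F (f x) (h x)) x - (\<lambda>x\<in>carrier G. F (f x) (h x)) (g \<otimes> x)\<bar> \<le> \<epsilon>"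
        using x gx by simp
    qed (use V W in auto)
  qed auto
qed

lemma RUCB_add:
  assumes "f \<in> RUCB G T" "h \<in> RUCB G T"
  shows "(\<lambda>x\<in>carrier G. f x + h x) \<in> RUCB G T"
proof (rule RUCB_combine[OF assms], intro exI allI impI)
  show "\<bar>s + t - (s' + t')\<bar> \<le> 1 * (\<bar>s - s'\<bar> + \<bar>t - t'\<bar>)" for s t s' t' :: real
    by (simp add: abs_if)
qed

lemma RUCB_scale:
  assumes "f \<in> RUCB G T"
  shows "(\<lambda>x\<in>carrier G. c * f x) \<in> RUCB G T"
proof (rule RUCB_combine[OF assms assms, of "\<lambda>s t. c * s"], intro exI allI impI)
  show "\<bar>c * s - c * s'\<bar> \<le> \<bar>c\<bar> * (\<bar>s - s'\<bar> + \<bar>t - t'\<bar>)" for s t s' t' :: real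
    by (simp add: mult_left_mono flip: right_diff_distrib abs_mult)
      (simp add: abs_mult mult_left_mono)
qed

lemma RUCB_diff_square:
  assumes "f \<in> RUCB G T"
  shows "(\<lambda>x\<in>carrier G. (f x - c)\<^sup>2) \<in> RUCB G T"
proof (rule RUCB_combine[OF assms assms, of "\<lambda>s t. (s - c)\<^sup>2"], intro exI allI impI)
  fix B s t s' t' :: real
  assume "\<bar>s\<bar> \<le> B" "\<bar>s'\<bar> \<le> B"
  have "(s - c)\<^sup>2 - (s' - c)\<^sup>2 = (s + s' - 2 * c) * (s - s')"
    by (simp add: power2_eq_square algebra_simps)
  then have "\<bar>(s - c)\<^sup>2 - (s' - c)\<^sup>2\<bar> = \<bar>s + s' - 2 * c\<bar> * \<bar>s - s'\<bar>"
    by (simp add: abs_mult)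
  also have "\<dots> \<le> (2 * B + 2 * \<bar>c\<bar>) * (\<bar>s - s'\<bar> + \<bar>t - t'\<bar>)"
    using \<open>\<bar>s\<bar> \<le> B\<close> \<open>\<bar>s'\<bar> \<le> B\<close> by (intro mult_mono) auto
  finally show "\<bar>(s - c)\<^sup>2 - (s' - c)\<^sup>2\<bar> \<le> (2 * B + 2 * \<bar>c\<bar>) * (\<bar>s - s'\<bar> + \<bar>t - t'\<bar>)" .
qed

lemma RUCB_sum:
  assumes "finite I" "\<And>i. i \<in> I \<Longrightarrow> f i \<in> RUCB G T"
  shows "(\<lambda>x\<in>carrier G. \<Sum>i\<in>I. f i x) \<in> RUCB G T"
  using assms
proof (induction I rule: finite_induct)
  case empty
  show ?case by (simp only: sum.empty RUCB_const)
next
  case (insert i I)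
  then have "(\<lambda>x\<in>carrier G. f i x + (\<lambda>x\<in>carrier G. \<Sum>i\<in>I. f i x) x) \<in> RUCB G T"
    by (intro RUCB_add) auto
  moreover have "(\<lambda>x\<in>carrier G. f i x + (\<lambda>x\<in>carrier G. \<Sum>i\<in>I. f i x) x) =
      (\<lambda>x\<in>carrier G. \<Sum>i\<in>insert i I. f i x)"
    using insert by (intro restrict_ext) simp
  ultimately show ?case by (simp only:)
qed

section \<open>Calculus of means and the variance of a mixture\<close>

lemma mean_add:
  "\<mu> \<in> means G T \<Longrightarrow> f \<in> RUCB G T \<Longrightarrow> h \<in> RUCB G T \<Longrightarrow>
    \<mu> (\<lambda>x\<in>carrier G. f x + h x) = \<mu> f + \<mu> h"
  by (simp add: means_def)

lemma mean_scale:
  "\<mu> \<in> means G T \<Longrightarrow> f \<in> RUCB G T \<Longrightarrow> \<mu> (\<lambda>x\<in>carrier G. c * f x) = c * \<mu> f"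
  by (simp add: means_def)

lemma mean_const: 
  assumes "\<mu> \<in> means G T"
  shows "\<mu> (\<lambda>x\<in>carrier G. c) = c"
proof -
  have "\<mu> (\<lambda>x\<in>carrier G. c * (\<lambda>x\<in>carrier G. 1) x) = c * 1"
    using assms RUCB_const[of 1] by (subst mean_scale) (auto simp: means_def)
  then show ?thesis
    by (simp cong: restrict_cong)
qed

lemma mean_mono:
  assumes \<mu>: "\<mu> \<in> means G T" and f: "f \<in> RUCB G T" and h: "h \<in> RUCB G T"
    and le: "\<And>x. x \<in> carrier G \<Longrightarrow> f x \<le> h x"
  shows "\<mu> f \<le> \<mu> h"
proof -
  have m: "(\<lambda>x\<in>carrier G. (-1) * f x) \<in> RUCB G T"
    by (rule RUCB_scale[OF f])
  have "0 \<le> \<mu> (\<lambda>x\<in>carrier G. h x + (\<lambda>x\<in>carrier G. (-1) * f x) x)"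
    using \<mu> RUCB_add[OF h m] le by (auto simp: means_def)
  then show ?thesis
    using mean_add[OF \<mu> h m] mean_scale[OF \<mu> f, of "-1"] by simp
qed

lemma mean_ge:
  assumes "\<mu> \<in> means G T" "f \<in> RUCB G T" "\<And>x. x \<in> carrier G \<Longrightarrow> c \<le> f x"
  shows "c \<le> \<mu> f"
  using mean_mono[OF assms(1) RUCB_const[of c] assms(2)] assms(3)
  by (simp only: mean_const[OF assms(1)] restrict_apply if_True)

lemma mean_le:
  assumes "\<mu> \<in> means G T" "f \<in> RUCB G T" "\<And>x. x \<in> carrier G \<Longrightarrow> f x \<le> c"
  shows "\<mu> f \<le> c"
  using mean_mono[OF assms(1,2) RUCB_const[of c]] assms(3)
  by (simp only: mean_const[OF assms(1)] restrict_apply if_True)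

lemma mean_close:
  assumes \<mu>: "\<mu> \<in> means G T" and f: "f \<in> RUCB G T" and h: "h \<in> RUCB G T"
    and close: "\<And>x. x \<in> carrier G \<Longrightarrow> \<bar>f x - h x\<bar> \<le> \<epsilon>"
  shows "\<bar>\<mu> f - \<mu> h\<bar> \<le> \<epsilon>"
proof -
  have *: "\<mu> p \<le> \<mu> q + \<epsilon>" if "p \<in> RUCB G T" "q \<in> RUCB G T"
    "\<And>x. x \<in> carrier G \<Longrightarrow> p x \<le> q x + \<epsilon>" for p q
  proof -
    have "(\<lambda>x\<in>carrier G. q x + (\<lambda>x\<in>carrier G. \<epsilon>) x) \<in> RUCB G T"
      by (intro RUCB_add that RUCB_const)
    then have "\<mu> p \<le> \<mu> (\<lambda>x\<in>carrier G. q x + (\<lambda>x\<in>carrier G. \<epsilon>) x)"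
      using that by (intro mean_mono[OF \<mu>]) auto
    then show ?thesis
      using mean_add[OF \<mu> that(2) RUCB_const[of \<epsilon>]] mean_const[OF \<mu>] by simp
  qed
  have "f x \<le> h x + \<epsilon>" "h x \<le> f x + \<epsilon>" if "x \<in> carrier G" for x
    using close[OF that] by linarith+
  then show ?thesis
    using *[of f h] *[of h f] f h by fastforce
qed

lemma mean_sum:
  assumes \<mu>: "\<mu> \<in> means G T" and "finite I" "\<And>i. i \<in> I \<Longrightarrow> f i \<in> RUCB G T"
  shows "\<mu> (\<lambda>x\<in>carrier G. \<Sum>i\<in>I. f i x) = (\<Sum>i\<in>I. \<mu> (f i))"
  using assms(2,3)
proof (induction I rule: finite_induct)
  case empty
  show ?case by (simp only: sum.empty mean_const[OF \<mu>])
next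
  case (insert i I)
  have "\<mu> (\<lambda>x\<in>carrier G. \<Sum>i\<in>insert i I. f i x) =
      \<mu> (\<lambda>x\<in>carrier G. f i x + (\<lambda>x\<in>carrier G. \<Sum>i\<in>I. f i x) x)"
    using insert by (intro arg_cong[of _ _ \<mu>] restrict_ext) simp
  also have "\<dots> = \<mu> (f i) + \<mu> (\<lambda>x\<in>carrier G. \<Sum>i\<in>I. f i x)"
    using insert by (intro mean_add[OF \<mu>] RUCB_sum) auto
  also have "\<mu> (\<lambda>x\<in>carrier G. \<Sum>i\<in>I. f i x) = (\<Sum>i\<in>I. \<mu> (f i))"
    using insert by blast
  also have "\<mu> (f i) + (\<Sum>i\<in>I. \<mu> (f i)) = (\<Sum>i\<in>insert i I. \<mu> (f i))"
    using insert.hyps by simp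
  finally show ?case .
qed

text \<open>Jensen's inequality for the square: with m = \<mu> f - c, the tangent of t^2 at m gives
  2 m (f - c) - m^2 \<le> (f - c)^2 pointwise, and the left side has mean m^2.\<close>

lemma mean_diff_square_ge:
  assumes \<mu>: "\<mu> \<in> means G T" and f: "f \<in> RUCB G T"
  shows "(\<mu> f - c)\<^sup>2 \<le> \<mu> (\<lambda>x\<in>carrier G. (f x - c)\<^sup>2)"
proof -
  let ?m = "\<mu> f - c"
  let ?l = "\<lambda>x\<in>carrier G. (2 * ?m) * f x"
  let ?k = "\<lambda>x\<in>carrier G. - 2 * ?m * c - ?m\<^sup>2"
  have l: "?l \<in> RUCB G T" by (rule RUCB_scale[OF f])
  have "\<mu> (\<lambda>x\<in>carrier G. ?l x + ?k x) \<le> \<mu> (\<lambda>x\<in>carrier G. (f x - c)\<^sup>2)"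
  proof (rule mean_mono[OF \<mu> RUCB_add[OF l RUCB_const] RUCB_diff_square[OF f]])
    fix x assume x: "x \<in> carrier G"
    have "0 \<le> (f x - c - ?m)\<^sup>2" by simp
    then show "(\<lambda>x\<in>carrier G. ?l x + ?k x) x \<le> (\<lambda>x\<in>carrier G. (f x - c)\<^sup>2) x"
      using x by (simp add: power2_eq_square algebra_simps)
  qed
  moreover have "\<mu> (\<lambda>x\<in>carrier G. ?l x + ?k x) = 2 * ?m * \<mu> f + (- 2 * ?m * c - ?m\<^sup>2)"
    by (subst mean_add[OF \<mu> l RUCB_const]) (simp only: mean_scale[OF \<mu> f] mean_const[OF \<mu>])
  ultimately show ?thesis
    by (simp add: power2_eq_square algebra_simps)
qed

lemma mean_average:
  assumes "\<alpha> \<in> means G T" "\<beta> \<in> means G T"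
  shows "(\<lambda>f. (\<alpha> f + \<beta> f) / 2) \<in> means G T"
  using assms by (simp add: means_def add_divide_distrib distrib_left)

lemma left_invariant_mean_average:
  assumes "left_invariant_mean G T \<alpha>" "left_invariant_mean G T \<beta>"
  shows "left_invariant_mean G T (\<lambda>f. (\<alpha> f + \<beta> f) / 2)"
  using assms mean_average by (auto simp: left_invariant_mean_def)

text \<open>The mixture's expectation of f is the midpoint of \<alpha> f and \<beta> f, at distance
  |\<alpha> f - \<beta> f| / 2 from each. By Jensen, each of the two means therefore has second
  moment at least a quarter of the squared gap about this center.\<close>

lemma mean_variance_average_ge:
  assumes \<alpha>: "\<alpha> \<in> means G T" and \<beta>: "\<beta> \<in> means G T" and f: "f \<in> RUCB G T"
  shows "(\<alpha> f - \<beta> f)\<^sup>2 / 4 \<le> mean_variance G (\<lambda>f. (\<alpha> f + \<beta> f) / 2) f"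
proof -
  let ?m = "(\<alpha> f + \<beta> f) / 2"
  have "(\<alpha> f - \<beta> f)\<^sup>2 / 4 = ((\<alpha> f - ?m)\<^sup>2 + (\<beta> f - ?m)\<^sup>2) / 2"
    by (simp add: power2_eq_square field_simps)
  also have "\<dots> \<le> mean_variance G (\<lambda>f. (\<alpha> f + \<beta> f) / 2) f"
    unfolding mean_variance_def
    using mean_diff_square_ge[OF \<alpha> f, of ?m] mean_diff_square_ge[OF \<beta> f, of ?m] by simp
  finally show ?thesis .
qed

section \<open>Limits of right translates of an invariant mean\<close>

text \<open>The mean is f \<mapsto> \<nu> (\<open>\<Phi> f\<close>), where \<open>\<Phi> f x\<close>
  is a generalized limit of \<open>f (x \<otimes> w k)\<close>. By associativity, right translation
  by \<open>w k\<close> commutes with left translations, so \<Phi> keeps the uniform modulus of f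
  and respects left invariance. Eventual bounds at points of \<open>D\<close> become bounds on
  \<open>\<Phi> f\<close> there, and uniform continuity spreads them over G.\<close>

lemma limit_mean_exists:
  assumes \<nu>: "left_invariant_mean G T \<nu>" and w: "\<And>k. w k \<in> carrier G"
    and dense: "D \<subseteq> carrier G" "\<And>U. openin T U \<Longrightarrow> U \<noteq> {} \<Longrightarrow> U \<inter> D \<noteq> {}"
    and transl: "\<And>x. x \<in> carrier G \<Longrightarrow> continuous_map T T (\<lambda>g. g \<otimes> x)"
  obtains \<mu> where "left_invariant_mean G T \<mu>"
    "\<forall>f\<in>RUCB G T. \<forall>c. (\<forall>x\<in>D. eventually (\<lambda>k. c \<le> f (x \<otimes> w k)) sequentially) \<longrightarrow> c \<le> \<mu> f"
proof -
  obtain L :: "(nat \<Rightarrow> real) \<Rightarrow> real"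
    where L_add: "\<And>u v. bounded (range u) \<Longrightarrow> bounded (range v) \<Longrightarrow> L (\<lambda>k. u k + v k) = L u + L v"
      and L_scale: "\<And>u c. bounded (range u) \<Longrightarrow> L (\<lambda>k. c * u k) = c * L u"
      and L_ge: "\<And>u c. bounded (range u) \<Longrightarrow> eventually (\<lambda>k. c \<le> u k) sequentially \<Longrightarrow> c \<le> L u"
    using generalized_limit_exists by blast
  \<comment> \<open>Lower bounds for both c and -c pin down the limit of a constant.\<close>
  have L_const: "L (\<lambda>k. c) = c" for c
  proof -
    have "L (\<lambda>k. c) \<ge> c" "L (\<lambda>k. (-1) * c) \<ge> - c"
      by (intro L_ge; simp)+
    moreover have "L (\<lambda>k. (-1) * c) = (-1) * L (\<lambda>k. c)"
      by (intro L_scale) simp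
    ultimately show ?thesis by simp
  qed
  have L_close: "\<bar>L u - L v\<bar> \<le> \<epsilon>"
    if u: "bounded (range u)" and v: "bounded (range v)" and close: "\<And>k. \<bar>u k - v k\<bar> \<le> \<epsilon>" for u v \<epsilon>
  proof -
    have *: "- \<epsilon> \<le> L p - L q" if p: "bounded (range p)" and q: "bounded (range q)"
      and le: "\<And>k. - \<epsilon> \<le> p k - q k" for p q
    proof -
      have q': "bounded (range (\<lambda>k. (-1) * q k))"
        using bounded_scaling[OF q, of "-1"] by (simp add: image_comp o_def)
      have "- \<epsilon> \<le> L (\<lambda>k. p k + (-1) * q k)"
        using le by (intro L_ge bounded_plus_comp p q') simp
      also have "\<dots> = L p - L q"
        using L_add[OF p q'] L_scale[OF q, of "-1"] by simp
      finally show ?thesis .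
    qed
    have "- \<epsilon> \<le> u k - v k" "- \<epsilon> \<le> v k - u k" for k
      using close[of k] by linarith+
    then show ?thesis
      using *[OF u v] *[OF v u] by fastforce
  qed
  define \<Phi> where "\<Phi> f = (\<lambda>x\<in>carrier G. L (\<lambda>k. f (x \<otimes> w k)))" for f
  have bdd: "bounded (range (\<lambda>k. f (x \<otimes> w k)))" if f: "f \<in> RUCB G T" and x: "x \<in> carrier G" for f x
  proof -
    obtain B where "\<And>x. x \<in> carrier G \<Longrightarrow> \<bar>f x\<bar> \<le> B"
      using RUCB_bound[OF f] by blast
    then have "\<forall>k. \<bar>f (x \<otimes> w k)\<bar> \<le> B"
      using w x by simp
    then show ?thesis
      by (auto simp: bounded_iff)
  qed
  have \<Phi>_close: "\<bar>\<Phi> f x - \<Phi> f (g \<otimes> x)\<bar> \<le> \<epsilon>"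
    if f: "f \<in> RUCB G T" and g: "g \<in> carrier G" and x: "x \<in> carrier G"
      and close: "\<And>x. x \<in> carrier G \<Longrightarrow> \<bar>f x - f (g \<otimes> x)\<bar> \<le> \<epsilon>" for f g x \<epsilon>
    using L_close[OF bdd[OF f x] bdd[OF f m_closed[OF g x]], of \<epsilon>] close[of "x \<otimes> w _"] w g x
    by (simp add: \<Phi>_def m_assoc)
  have \<Phi>_RUCB: "\<Phi> f \<in> RUCB G T" if f: "f \<in> RUCB G T" for f
  proof -
    obtain B where B: "\<And>x. x \<in> carrier G \<Longrightarrow> \<bar>f x\<bar> \<le> B"
      using RUCB_bound[OF f] by blast
    show ?thesis
    proof (rule RUCB_I)
      show "\<Phi> f \<in> extensional (carrier G)" by (simp add: \<Phi>_def)
    next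
      fix x assume x: "x \<in> carrier G"
      have "\<bar>L (\<lambda>k. f (x \<otimes> w k)) - L (\<lambda>k. 0)\<bar> \<le> B"
        using B w x by (intro L_close bdd[OF f x]) auto
      then show "\<bar>\<Phi> f x\<bar> \<le> B"
        using x by (simp add: \<Phi>_def L_const)
    next
      fix \<epsilon> :: real
      assume "\<epsilon> > 0"
      from RUCB_unif[OF f this] obtain V where V: "openin T V" "\<one> \<in> V" "V \<subseteq> carrier G"
        "\<And>g x. g \<in> V \<Longrightarrow> x \<in> carrier G \<Longrightarrow> \<bar>f x - f (g \<otimes> x)\<bar> \<le> \<epsilon>"
        by blast
      then show "\<exists>V. openin T V \<and> \<one> \<in> V \<and> (\<forall>g\<in>V. \<forall>x\<in>carrier G. \<bar>\<Phi> f x - \<Phi> f (g \<otimes> x)\<bar> \<le> \<epsilon>)"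
        by (intro exI[of _ V] conjI ballI \<Phi>_close[OF f]) auto
    qed
  qed
  have \<nu>m: "\<nu> \<in> means G T"
    using \<nu> by (simp add: left_invariant_mean_def)
  have "(\<lambda>f. \<nu> (\<Phi> f)) \<in> means G T"
    unfolding means_def mem_Collect_eq
  proof (intro conjI ballI allI impI)
    fix f h assume f: "f \<in> RUCB G T" and h: "h \<in> RUCB G T"
    have "\<Phi> (\<lambda>x\<in>carrier G. f x + h x) = (\<lambda>x\<in>carrier G. \<Phi> f x + \<Phi> h x)"
      using L_add[OF bdd[OF f] bdd[OF h]] w by (auto simp: \<Phi>_def intro!: restrict_ext)
    then show "\<nu> (\<Phi> (\<lambda>x\<in>carrier G. f x + h x)) = \<nu> (\<Phi> f) + \<nu> (\<Phi> h)"
      using mean_add[OF \<nu>m \<Phi>_RUCB[OF f] \<Phi>_RUCB[OF h]] by (simp only:)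
  next
    fix f c assume f: "f \<in> RUCB G T"
    have "\<Phi> (\<lambda>x\<in>carrier G. c * f x) = (\<lambda>x\<in>carrier G. c * \<Phi> f x)"
      using L_scale[OF bdd[OF f]] w by (auto simp: \<Phi>_def intro!: restrict_ext)
    then show "\<nu> (\<Phi> (\<lambda>x\<in>carrier G. c * f x)) = c * \<nu> (\<Phi> f)"
      using mean_scale[OF \<nu>m \<Phi>_RUCB[OF f]] by (simp only:)
  next
    fix f assume f: "f \<in> RUCB G T" and pos: "\<forall>x\<in>carrier G. 0 \<le> f x"
    then have "0 \<le> \<Phi> f x" if "x \<in> carrier G" for x
      using that w L_ge[OF bdd[OF f that], of 0] by (simp add: \<Phi>_def)
    then show "0 \<le> \<nu> (\<Phi> f)"
      by (intro mean_ge[OF \<nu>m \<Phi>_RUCB[OF f]])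
  next
    have "\<Phi> (\<lambda>x\<in>carrier G. 1) = (\<lambda>x\<in>carrier G. 1)"
      using w by (auto simp: \<Phi>_def L_const intro!: restrict_ext)
    then show "\<nu> (\<Phi> (\<lambda>x\<in>carrier G. 1)) = 1"
      using mean_const[OF \<nu>m, of 1] by (simp only:)
  qed
  moreover have "\<nu> (\<Phi> (left_translate G g f)) = \<nu> (\<Phi> f)" if f: "f \<in> RUCB G T" and g: "g \<in> carrier G" for f g
  proof -
    have "\<Phi> (left_translate G g f) = left_translate G g (\<Phi> f)"
      using w g by (auto simp: \<Phi>_def left_translate_def m_assoc intro!: restrict_ext)
    then show ?thesis
      using \<nu> \<Phi>_RUCB[OF f] g by (simp add: left_invariant_mean_def)
  qed
  moreover have "c \<le> \<nu> (\<Phi> f)"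
    if f: "f \<in> RUCB G T" and ev: "\<And>x. x \<in> D \<Longrightarrow> eventually (\<lambda>k. c \<le> f (x \<otimes> w k)) sequentially" for f c
  proof (rule mean_ge[OF \<nu>m \<Phi>_RUCB[OF f]], rule field_le_epsilon)
    fix x and \<epsilon> :: real
    assume x: "x \<in> carrier G" and "\<epsilon> > 0"
    from RUCB_unif[OF f this(2)] obtain V where V: "openin T V" "\<one> \<in> V" "V \<subseteq> carrier G"
      "\<And>g x. g \<in> V \<Longrightarrow> x \<in> carrier G \<Longrightarrow> \<bar>f x - f (g \<otimes> x)\<bar> \<le> \<epsilon>"
      by blast
    \<comment> \<open>This set is V x, an open neighborhood of x, so it meets \<open>D\<close> in
      some y. Since y arises from x by the left factor y x^{-1} in V, \<open>\<Phi> f\<close>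
      differs by at most \<epsilon> between x and y.\<close>
    have "openin T {y \<in> topspace T. y \<otimes> inv x \<in> V}"
      using openin_continuous_map_preimage[OF transl V(1)] x by blast
    moreover have "x \<in> {y \<in> topspace T. y \<otimes> inv x \<in> V}"
      using x V(2) by (simp add: topspace_eq)
    ultimately obtain y where y: "y \<in> D" "y \<in> carrier G" "y \<otimes> inv x \<in> V"
      using dense(2) by (fastforce simp: topspace_eq)
    have "y = y \<otimes> inv x \<otimes> x"
      using x y by (simp add: m_assoc)
    then have "\<bar>\<Phi> f x - \<Phi> f y\<bar> \<le> \<epsilon>"
      using \<Phi>_close[OF f _ x V(4)[OF y(3)]] y(2) x by simp
    moreover have "c \<le> \<Phi> f y"
      using L_ge[OF bdd[OF f y(2)] ev[OF y(1)]] y(2) by (simp add: \<Phi>_def)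
    ultimately show "c \<le> \<Phi> f x + \<epsilon>"
      by linarith
  qed
  ultimately show thesis
    using that[of "\<lambda>f. \<nu> (\<Phi> f)"] by (simp add: left_invariant_mean_def)
qed

end

section \<open>Powers of means\<close>

text \<open>The last coordinate is integrated first. For n = 0 the power is the single point
  \<open>\<lambda>_. undefined\<close>, the only extensional function on the empty index set. The
  restrictions make both integrands extensional, as \<open>RUCB\<close> demands.\<close>

primrec mean_power ::
  "('a, 'b) monoid_scheme \<Rightarrow> (('a \<Rightarrow> real) \<Rightarrow> real) \<Rightarrow> nat \<Rightarrow> ((nat \<Rightarrow> 'a) \<Rightarrow> real) \<Rightarrow> real" where
  "mean_power G \<mu> 0 f = f (\<lambda>_. undefined)"
| "mean_power G \<mu> (Suc n) f =
     mean_power G \<mu> n (\<lambda>x\<in>carrier (group_power G n). \<mu> (\<lambda>t\<in>carrier G. f (x(Suc n := t))))"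

lemma carrier_group_power: "carrier (group_power G n) = (\<Pi>\<^sub>E i\<in>{1..n}. carrier G)"
  by (simp add: group_power_def)

lemma carrier_group_power_Suc_iff:
  "x \<in> carrier (group_power G (Suc n)) \<longleftrightarrow>
     (\<exists>y\<in>carrier (group_power G n). \<exists>t\<in>carrier G. x = y(Suc n := t))"
proof
  assume x: "x \<in> carrier (group_power G (Suc n))"
  then have "restrict x {1..n} \<in> carrier (group_power G n)" "x (Suc n) \<in> carrier G"
    by (auto simp: carrier_group_power)
  moreover have "x = (restrict x {1..n})(Suc n := x (Suc n))"
    using x by (auto simp: carrier_group_power PiE_def extensional_def fun_eq_iff)
  ultimately show "\<exists>y\<in>carrier (group_power G n). \<exists>t\<in>carrier G. x = y(Suc n := t)"
    by blast
next
  assume "\<exists>y\<in>carrier (group_power G n). \<exists>t\<in>carrier G. x = y(Suc n := t)"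
  then show "x \<in> carrier (group_power G (Suc n))"
    by (auto simp: carrier_group_power PiE_def extensional_def Pi_def le_Suc_eq)
qed

lemma mult_group_power_Suc:
  "x(Suc n := t) \<otimes>\<^bsub>group_power G (Suc n)\<^esub> y(Suc n := s) =
     (x \<otimes>\<^bsub>group_power G n\<^esub> y)(Suc n := t \<otimes>\<^bsub>G\<^esub> s)"
proof
  fix k
  show "(x(Suc n := t) \<otimes>\<^bsub>group_power G (Suc n)\<^esub> y(Suc n := s)) k =
      ((x \<otimes>\<^bsub>group_power G n\<^esub> y)(Suc n := t \<otimes>\<^bsub>G\<^esub> s)) k"
    by (cases "k = Suc n") (auto simp: group_power_def)
qed

lemma one_group_power_Suc:
  "\<one>\<^bsub>group_power G (Suc n)\<^esub> = \<one>\<^bsub>group_power G n\<^esub>(Suc n := \<one>\<^bsub>G\<^esub>)"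
proof
  show "\<one>\<^bsub>group_power G (Suc n)\<^esub> k = (\<one>\<^bsub>group_power G n\<^esub>(Suc n := \<one>\<^bsub>G\<^esub>)) k" for k
    by (cases "k = Suc n") (auto simp: group_power_def)
qed

context topologized_group
begin

lemma group_power_topologized: "topologized_group (group_power G n) (topology_power T n)"
proof -
  have "group (group_power G n)"
    unfolding group_power_def by (rule product_group) (rule is_group)
  moreover have "topspace (topology_power T n) = carrier (group_power G n)"
    by (simp add: topology_power_def carrier_group_power topspace_eq)
  ultimately show ?thesis
    by (simp add: topologized_group_def topologized_group_axioms_def)
qed

lemma continuous_map_update_last:
  assumes "x \<in> carrier (group_power G n)"
  shows "continuous_map T (topology_power T (Suc n)) (\<lambda>t. x(Suc n := t))"
proof -
  have "continuous_map T T (\<lambda>t. (x(Suc n := t)) k)" if "k \<in> {1..Suc n}" for k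
    using that assms by (cases "k = Suc n") (auto simp: carrier_group_power topspace_eq)
  then show ?thesis
    using assms unfolding topology_power_def continuous_map_componentwise
    by (auto simp: carrier_group_power PiE_def extensional_def)
qed

lemma continuous_map_append:
  assumes "t \<in> carrier G"
  shows "continuous_map (topology_power T n) (topology_power T (Suc n)) (\<lambda>x. x(Suc n := t))"
proof -
  have "continuous_map (topology_power T n) T (\<lambda>x. (x(Suc n := t)) k)" if "k \<in> {1..Suc n}" for k
    using that assms
    by (cases "k = Suc n") (auto simp: topology_power_def topspace_eq intro: continuous_map_product_projection)
  then show ?thesis
    unfolding topology_power_def[of T "Suc n"] continuous_map_componentwise
    by (auto simp: topology_power_def PiE_def extensional_def)
qed

text \<open>A group element that is trivial outside coordinate n + 1 moves only t. Pulling V back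
  along the insertion of t into the identity of the power yields the required neighborhood.\<close>

lemma section_RUCB:
  assumes f: "f \<in> RUCB (group_power G (Suc n)) (topology_power T (Suc n))"
    and x: "x \<in> carrier (group_power G n)"
  shows "(\<lambda>t\<in>carrier G. f (x(Suc n := t))) \<in> RUCB G T"
proof -
  interpret P: topologized_group "group_power G n" "topology_power T n"
    by (rule group_power_topologized)
  interpret S: topologized_group "group_power G (Suc n)" "topology_power T (Suc n)"
    by (rule group_power_topologized)
  have mem: "x(Suc n := t) \<in> carrier (group_power G (Suc n))" if "t \<in> carrier G" for t
    using that x by (auto simp: carrier_group_power_Suc_iff)
  obtain B where "\<And>x. x \<in> carrier (group_power G (Suc n)) \<Longrightarrow> \<bar>f x\<bar> \<le> B"
    using S.RUCB_bound[OF f] by blast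
  then show ?thesis
  proof (intro RUCB_I[of _ B])
    fix \<epsilon> :: real
    assume "\<epsilon> > 0"
    from S.RUCB_unif[OF f this] obtain V where V: "openin (topology_power T (Suc n)) V"
      "\<one>\<^bsub>group_power G (Suc n)\<^esub> \<in> V" "V \<subseteq> carrier (group_power G (Suc n))"
      "\<And>g x. g \<in> V \<Longrightarrow> x \<in> carrier (group_power G (Suc n)) \<Longrightarrow>
         \<bar>f x - f (g \<otimes>\<^bsub>group_power G (Suc n)\<^esub> x)\<bar> \<le> \<epsilon>"
      by blast
    let ?W = "{t \<in> topspace T. \<one>\<^bsub>group_power G n\<^esub>(Suc n := t) \<in> V}"
    have "openin T ?W"
      using openin_continuous_map_preimage[OF continuous_map_update_last[OF P.one_closed] V(1)] .
    moreover have "\<one> \<in> ?W"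
      using V(2) by (simp add: one_group_power_Suc topspace_eq)
    moreover have "\<bar>f (x(Suc n := t)) - f (x(Suc n := g \<otimes> t))\<bar> \<le> \<epsilon>" if "g \<in> ?W" "t \<in> carrier G" for g t
      using V(4)[of "\<one>\<^bsub>group_power G n\<^esub>(Suc n := g)" "x(Suc n := t)"] that mem x
      by (simp add: mult_group_power_Suc)
    ultimately show "\<exists>V. openin T V \<and> \<one> \<in> V \<and> (\<forall>g\<in>V. \<forall>t\<in>carrier G.
        \<bar>(\<lambda>t\<in>carrier G. f (x(Suc n := t))) t - (\<lambda>t\<in>carrier G. f (x(Suc n := t))) (g \<otimes> t)\<bar> \<le> \<epsilon>)"
      by (intro exI[of _ ?W]) (auto simp: topspace_eq)
  qed (use mem in auto)
qed

text \<open>Elements with last coordinate 1 move x but not t. The sections of f before and after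
  such a move are therefore \<epsilon>-close uniformly in t, which \<open>mean_close\<close> turns
  into closeness of their means. This uniformity plays the part of measurability in forming iterated
  integrals.\<close>

lemma section_mean_RUCB:
  assumes \<mu>: "\<mu> \<in> means G T"
    and f: "f \<in> RUCB (group_power G (Suc n)) (topology_power T (Suc n))"
  shows "(\<lambda>x\<in>carrier (group_power G n). \<mu> (\<lambda>t\<in>carrier G. f (x(Suc n := t))))
           \<in> RUCB (group_power G n) (topology_power T n)"
proof -
  interpret P: topologized_group "group_power G n" "topology_power T n"
    by (rule group_power_topologized)
  interpret S: topologized_group "group_power G (Suc n)" "topology_power T (Suc n)"
    by (rule group_power_topologized)
  let ?F = "\<lambda>x\<in>carrier (group_power G n). \<mu> (\<lambda>t\<in>carrier G. f (x(Suc n := t)))"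
  have mem: "x(Suc n := t) \<in> carrier (group_power G (Suc n))"
    if "x \<in> carrier (group_power G n)" "t \<in> carrier G" for x t
    using that by (auto simp: carrier_group_power_Suc_iff)
  obtain B where B: "\<And>x. x \<in> carrier (group_power G (Suc n)) \<Longrightarrow> \<bar>f x\<bar> \<le> B"
    using S.RUCB_bound[OF f] by blast
  show ?thesis
  proof (rule P.RUCB_I)
    fix x assume x: "x \<in> carrier (group_power G n)"
    have "- B \<le> \<mu> (\<lambda>t\<in>carrier G. f (x(Suc n := t)))" "\<mu> (\<lambda>t\<in>carrier G. f (x(Suc n := t))) \<le> B"
      using B[OF mem[OF x]]
      by (auto intro!: mean_ge[OF \<mu> section_RUCB[OF f x]] mean_le[OF \<mu> section_RUCB[OF f x]]
          simp: abs_le_iff minus_le_iff)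
    then show "\<bar>?F x\<bar> \<le> B"
      using x by simp
  next
    fix \<epsilon> :: real
    assume "\<epsilon> > 0"
    from S.RUCB_unif[OF f this] obtain V where V: "openin (topology_power T (Suc n)) V"
      "\<one>\<^bsub>group_power G (Suc n)\<^esub> \<in> V" "V \<subseteq> carrier (group_power G (Suc n))"
      "\<And>g x. g \<in> V \<Longrightarrow> x \<in> carrier (group_power G (Suc n)) \<Longrightarrow>
         \<bar>f x - f (g \<otimes>\<^bsub>group_power G (Suc n)\<^esub> x)\<bar> \<le> \<epsilon>"
      by blast
    let ?W = "{g \<in> topspace (topology_power T n). g(Suc n := \<one>) \<in> V}"
    have "openin (topology_power T n) ?W"
      using openin_continuous_map_preimage[OF continuous_map_append[OF one_closed] V(1)] .
    moreover have "\<one>\<^bsub>group_power G n\<^esub> \<in> ?W"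
      using V(2) by (simp add: one_group_power_Suc P.topspace_eq)
    moreover have "\<bar>?F x - ?F (g \<otimes>\<^bsub>group_power G n\<^esub> x)\<bar> \<le> \<epsilon>"
      if g: "g \<in> ?W" and x: "x \<in> carrier (group_power G n)" for g x
    proof -
      have gx: "g \<otimes>\<^bsub>group_power G n\<^esub> x \<in> carrier (group_power G n)"
        using g x by (simp add: P.topspace_eq)
      have "\<bar>f (x(Suc n := t)) - f ((g \<otimes>\<^bsub>group_power G n\<^esub> x)(Suc n := t))\<bar> \<le> \<epsilon>"
        if "t \<in> carrier G" for t
        using V(4)[of "g(Suc n := \<one>)" "x(Suc n := t)"] that g mem[OF x that]
        by (simp add: mult_group_power_Suc)
      then have "\<bar>\<mu> (\<lambda>t\<in>carrier G. f (x(Suc n := t))) -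
          \<mu> (\<lambda>t\<in>carrier G. f ((g \<otimes>\<^bsub>group_power G n\<^esub> x)(Suc n := t)))\<bar> \<le> \<epsilon>"
        by (intro mean_close[OF \<mu> section_RUCB[OF f x] section_RUCB[OF f gx]]) simp
      then show ?thesis
        using x gx by simp
    qed
    ultimately show "\<exists>V. openin (topology_power T n) V \<and> \<one>\<^bsub>group_power G n\<^esub> \<in> V \<and>
        (\<forall>g\<in>V. \<forall>x\<in>carrier (group_power G n). \<bar>?F x - ?F (g \<otimes>\<^bsub>group_power G n\<^esub> x)\<bar> \<le> \<epsilon>)"
      by blast
  qed simp
qed

lemma mean_power_means:
  assumes \<mu>: "\<mu> \<in> means G T"
  shows "mean_power G \<mu> n \<in> means (group_power G n) (topology_power T n)"
proof (induction n)
  case 0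
  then show ?case
    by (simp add: means_def carrier_group_power)
next
  case (Suc n)
  interpret P: topologized_group "group_power G n" "topology_power T n"
    by (rule group_power_topologized)
  interpret S: topologized_group "group_power G (Suc n)" "topology_power T (Suc n)"
    by (rule group_power_topologized)
  define \<Phi> where "\<Phi> f = (\<lambda>x\<in>carrier (group_power G n). \<mu> (\<lambda>t\<in>carrier G. f (x(Suc n := t))))" for f
  have \<Phi>: "\<Phi> f \<in> RUCB (group_power G n) (topology_power T n)"
    if "f \<in> RUCB (group_power G (Suc n)) (topology_power T (Suc n))" for f
    unfolding \<Phi>_def by (rule section_mean_RUCB[OF \<mu> that])
  have pw: "mean_power G \<mu> (Suc n) f = mean_power G \<mu> n (\<Phi> f)" for f
    by (simp add: \<Phi>_def)
  have mem: "x(Suc n := t) \<in> carrier (group_power G (Suc n))"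
    if "x \<in> carrier (group_power G n)" "t \<in> carrier G" for x t
    using that by (auto simp: carrier_group_power_Suc_iff)
  show ?case
    unfolding means_def mem_Collect_eq
  proof (intro conjI ballI allI impI)
    fix f h assume f: "f \<in> RUCB (group_power G (Suc n)) (topology_power T (Suc n))"
      and h: "h \<in> RUCB (group_power G (Suc n)) (topology_power T (Suc n))"
    have "\<Phi> (\<lambda>x\<in>carrier (group_power G (Suc n)). f x + h x) =
        (\<lambda>x\<in>carrier (group_power G n). \<Phi> f x + \<Phi> h x)"
      unfolding \<Phi>_def
    proof (rule restrict_ext)
      fix x assume x: "x \<in> carrier (group_power G n)"
      have "(\<lambda>t\<in>carrier G. (\<lambda>x\<in>carrier (group_power G (Suc n)). f x + h x) (x(Suc n := t))) =
          (\<lambda>t\<in>carrier G. (\<lambda>t\<in>carrier G. f (x(Suc n := t))) t + (\<lambda>t\<in>carrier G. h (x(Suc n := t))) t)"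
        using mem[OF x] by (intro restrict_ext) simp
      then show "\<mu> (\<lambda>t\<in>carrier G. (\<lambda>x\<in>carrier (group_power G (Suc n)). f x + h x) (x(Suc n := t))) =
          (\<lambda>x\<in>carrier (group_power G n). \<mu> (\<lambda>t\<in>carrier G. f (x(Suc n := t)))) x +
          (\<lambda>x\<in>carrier (group_power G n). \<mu> (\<lambda>t\<in>carrier G. h (x(Suc n := t)))) x"
        using mean_add[OF \<mu> section_RUCB[OF f x] section_RUCB[OF h x]] x
        by (simp only: restrict_apply if_True)
    qed
    then show "mean_power G \<mu> (Suc n) (\<lambda>x\<in>carrier (group_power G (Suc n)). f x + h x) =
        mean_power G \<mu> (Suc n) f + mean_power G \<mu> (Suc n) h"
      unfolding pw using P.mean_add[OF Suc.IH \<Phi>[OF f] \<Phi>[OF h]] by (simp only:)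
  next
    fix f c assume f: "f \<in> RUCB (group_power G (Suc n)) (topology_power T (Suc n))"
    have "\<Phi> (\<lambda>x\<in>carrier (group_power G (Suc n)). c * f x) =
        (\<lambda>x\<in>carrier (group_power G n). c * \<Phi> f x)"
      unfolding \<Phi>_def
    proof (rule restrict_ext)
      fix x assume x: "x \<in> carrier (group_power G n)"
      have "(\<lambda>t\<in>carrier G. (\<lambda>x\<in>carrier (group_power G (Suc n)). c * f x) (x(Suc n := t))) =
          (\<lambda>t\<in>carrier G. c * (\<lambda>t\<in>carrier G. f (x(Suc n := t))) t)"
        using mem[OF x] by (intro restrict_ext) simp
      then show "\<mu> (\<lambda>t\<in>carrier G. (\<lambda>x\<in>carrier (group_power G (Suc n)). c * f x) (x(Suc n := t))) =
          c * (\<lambda>x\<in>carrier (group_power G n). \<mu> (\<lambda>t\<in>carrier G. f (x(Suc n := t)))) x"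
        using mean_scale[OF \<mu> section_RUCB[OF f x]] x
        by (simp only: restrict_apply if_True)
    qed
    then show "mean_power G \<mu> (Suc n) (\<lambda>x\<in>carrier (group_power G (Suc n)). c * f x) =
        c * mean_power G \<mu> (Suc n) f"
      unfolding pw using P.mean_scale[OF Suc.IH \<Phi>[OF f]] by (simp only:)
  next
    fix f assume f: "f \<in> RUCB (group_power G (Suc n)) (topology_power T (Suc n))"
      and pos: "\<forall>x\<in>carrier (group_power G (Suc n)). 0 \<le> f x"
    have "0 \<le> \<Phi> f x" if x: "x \<in> carrier (group_power G n)" for x
    proof -
      have "0 \<le> \<mu> (\<lambda>t\<in>carrier G. f (x(Suc n := t)))"
        using pos mem[OF x] by (intro mean_ge[OF \<mu> section_RUCB[OF f x]]) simp
      then show ?thesis using x by (simp add: \<Phi>_def)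
    qed
    then show "0 \<le> mean_power G \<mu> (Suc n) f"
      unfolding pw by (intro P.mean_ge[OF Suc.IH \<Phi>[OF f]])
  next
    have "\<Phi> (\<lambda>x\<in>carrier (group_power G (Suc n)). 1) = (\<lambda>x\<in>carrier (group_power G n). 1)"
      unfolding \<Phi>_def
    proof (rule restrict_ext)
      fix x assume x: "x \<in> carrier (group_power G n)"
      have "(\<lambda>t\<in>carrier G. (\<lambda>x\<in>carrier (group_power G (Suc n)). 1) (x(Suc n := t))) =
          (\<lambda>t\<in>carrier G. 1 :: real)"
        using mem[OF x] by (intro restrict_ext) simp
      then show "\<mu> (\<lambda>t\<in>carrier G. (\<lambda>x\<in>carrier (group_power G (Suc n)). 1) (x(Suc n := t))) = 1"
        using mean_const[OF \<mu>, of 1] by (simp only:)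
    qed
    then show "mean_power G \<mu> (Suc n) (\<lambda>x\<in>carrier (group_power G (Suc n)). 1) = 1"
      unfolding pw using P.mean_const[OF Suc.IH, of 1] by (simp only:)
  qed
qed

text \<open>Split the translating element into its last coordinate s and the rest g'. The inner mean
  absorbs s by invariance of \<mu>, and the outer iterated mean absorbs g' by induction.\<close>

lemma mean_power_left_invariant:
  assumes \<mu>: "left_invariant_mean G T \<mu>"
  shows "left_invariant_mean (group_power G n) (topology_power T n) (mean_power G \<mu> n)"
proof -
  have \<mu>m: "\<mu> \<in> means G T"
    using \<mu> by (simp add: left_invariant_mean_def)
  have "mean_power G \<mu> n (left_translate (group_power G n) g f) = mean_power G \<mu> n f"
    if "f \<in> RUCB (group_power G n) (topology_power T n)" "g \<in> carrier (group_power G n)" for f g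
    using that
  proof (induction n arbitrary: f g)
    case 0
    then show ?case
      by (simp add: left_translate_def group_power_def restrict_def)
  next
    case (Suc n)
    interpret P: topologized_group "group_power G n" "topology_power T n"
      by (rule group_power_topologized)
    define \<Phi> where "\<Phi> f = (\<lambda>x\<in>carrier (group_power G n). \<mu> (\<lambda>t\<in>carrier G. f (x(Suc n := t))))" for f
    obtain g' s where g: "g = g'(Suc n := s)" and g': "g' \<in> carrier (group_power G n)" and s: "s \<in> carrier G"
      using Suc.prems(2) by (auto simp: carrier_group_power_Suc_iff)
    have mem: "x(Suc n := t) \<in> carrier (group_power G (Suc n))"
      if "x \<in> carrier (group_power G n)" "t \<in> carrier G" for x t
      using that by (auto simp: carrier_group_power_Suc_iff)
    have "\<Phi> (left_translate (group_power G (Suc n)) g f) = left_translate (group_power G n) g' (\<Phi> f)"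
      unfolding \<Phi>_def left_translate_def[of "group_power G n"]
    proof (rule restrict_ext)
      fix x assume x: "x \<in> carrier (group_power G n)"
      then have gx: "g' \<otimes>\<^bsub>group_power G n\<^esub> x \<in> carrier (group_power G n)"
        using g' by simp
      have "(\<lambda>t\<in>carrier G. left_translate (group_power G (Suc n)) g f (x(Suc n := t))) =
          left_translate G s (\<lambda>t\<in>carrier G. f ((g' \<otimes>\<^bsub>group_power G n\<^esub> x)(Suc n := t)))"
        (is "?l = _")
        unfolding left_translate_def[of G]
        using mem[OF x] s by (intro restrict_ext) (simp add: left_translate_def g mult_group_power_Suc)
      then have "\<mu> ?l = \<mu> (left_translate G s (\<lambda>t\<in>carrier G. f ((g' \<otimes>\<^bsub>group_power G n\<^esub> x)(Suc n := t))))"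
        by (rule arg_cong)
      also have "\<dots> = \<mu> (\<lambda>t\<in>carrier G. f ((g' \<otimes>\<^bsub>group_power G n\<^esub> x)(Suc n := t)))"
        using \<mu> s section_RUCB[OF Suc.prems(1) gx] unfolding left_invariant_mean_def by blast
      finally show "\<mu> (\<lambda>t\<in>carrier G. left_translate (group_power G (Suc n)) g f (x(Suc n := t))) =
          (\<lambda>x\<in>carrier (group_power G n). \<mu> (\<lambda>t\<in>carrier G. f (x(Suc n := t))))
            (g' \<otimes>\<^bsub>group_power G n\<^esub> x)"
        using gx by (simp only: restrict_apply if_True)
    qed
    moreover have "mean_power G \<mu> n (left_translate (group_power G n) g' (\<Phi> f)) = mean_power G \<mu> n (\<Phi> f)"
      unfolding \<Phi>_def by (intro Suc.IH section_mean_RUCB[OF \<mu>m Suc.prems(1)] g')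
    ultimately show ?case
      by (simp add: \<Phi>_def)
  qed
  then show ?thesis
    using mean_power_means[OF \<mu>m] by (simp add: left_invariant_mean_def)
qed

section \<open>Coordinate marginals and averages\<close>

lemma coordinate_RUCB:
  assumes f: "f \<in> RUCB G T" and j: "j \<in> {1..n}"
  shows "(\<lambda>x\<in>carrier (group_power G n). f (x j)) \<in> RUCB (group_power G n) (topology_power T n)"
proof -
  interpret P: topologized_group "group_power G n" "topology_power T n"
    by (rule group_power_topologized)
  have mem: "x j \<in> carrier G" if "x \<in> carrier (group_power G n)" for x
    using that j by (auto simp: carrier_group_power)
  obtain B where "\<And>x. x \<in> carrier G \<Longrightarrow> \<bar>f x\<bar> \<le> B"
    using RUCB_bound[OF f] by blast
  then show ?thesis
  proof (intro P.RUCB_I[of _ B])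
    fix \<epsilon> :: real
    assume "\<epsilon> > 0"
    from RUCB_unif[OF f this] obtain V where V: "openin T V" "\<one> \<in> V" "V \<subseteq> carrier G"
      "\<And>g x. g \<in> V \<Longrightarrow> x \<in> carrier G \<Longrightarrow> \<bar>f x - f (g \<otimes> x)\<bar> \<le> \<epsilon>"
      by blast
    let ?W = "{g \<in> topspace (topology_power T n). g j \<in> V}"
    have "continuous_map (topology_power T n) T (\<lambda>x. x j)"
      unfolding topology_power_def using j by (rule continuous_map_product_projection)
    then have "openin (topology_power T n) ?W"
      by (rule openin_continuous_map_preimage[OF _ V(1)])
    moreover have "\<one>\<^bsub>group_power G n\<^esub> \<in> ?W"
      using V(2) j P.one_closed by (simp add: P.topspace_eq) (simp add: group_power_def)
    moreover have "\<bar>f (x j) - f ((g \<otimes>\<^bsub>group_power G n\<^esub> x) j)\<bar> \<le> \<epsilon>"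
      if "g \<in> ?W" "x \<in> carrier (group_power G n)" for g x
      using V(4)[of "g j" "x j"] that mem j by (simp add: group_power_def)
    ultimately show "\<exists>V. openin (topology_power T n) V \<and> \<one>\<^bsub>group_power G n\<^esub> \<in> V \<and>
        (\<forall>g\<in>V. \<forall>x\<in>carrier (group_power G n).
          \<bar>(\<lambda>x\<in>carrier (group_power G n). f (x j)) x -
           (\<lambda>x\<in>carrier (group_power G n). f (x j)) (g \<otimes>\<^bsub>group_power G n\<^esub> x)\<bar> \<le> \<epsilon>)"
      by (intro exI[of _ ?W]) (auto simp: P.topspace_eq)
  qed (use mem in auto)
qed

text \<open>Integrating the last coordinate either gives the constant \<mu> f, if that coordinate is
  j, or integrates a function that is constant in it. The rest is induction.\<close>

lemma mean_power_coordinate: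
  assumes \<mu>: "\<mu> \<in> means G T" and f: "f \<in> RUCB G T" and j: "j \<in> {1..n}"
  shows "mean_power G \<mu> n (\<lambda>x\<in>carrier (group_power G n). f (x j)) = \<mu> f"
  using j
proof (induction n)
  case 0
  then show ?case by simp
next
  case (Suc n)
  interpret P: topologized_group "group_power G n" "topology_power T n"
    by (rule group_power_topologized)
  have mem: "x(Suc n := t) \<in> carrier (group_power G (Suc n))"
    if "x \<in> carrier (group_power G n)" "t \<in> carrier G" for x t
    using that by (auto simp: carrier_group_power_Suc_iff)
  show ?case
  proof (cases "j = Suc n")
    case True
    have "(\<lambda>t\<in>carrier G. (\<lambda>x\<in>carrier (group_power G (Suc n)). f (x j)) (x(Suc n := t))) = f"
      if "x \<in> carrier (group_power G n)" for x
      using mem[OF that] True RUCB_extensional[OF f]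
      by (intro extensionalityI[of _ "carrier G"]) auto
    then have "(\<lambda>x\<in>carrier (group_power G n).
          \<mu> (\<lambda>t\<in>carrier G. (\<lambda>x\<in>carrier (group_power G (Suc n)). f (x j)) (x(Suc n := t)))) =
        (\<lambda>x\<in>carrier (group_power G n). \<mu> f)"
      by (intro restrict_ext) (simp only:)
    then show ?thesis
      using P.mean_const[OF mean_power_means[OF \<mu>], of "\<mu> f"] by (simp only: mean_power.simps)
  next
    case False
    have "(\<lambda>t\<in>carrier G. (\<lambda>x\<in>carrier (group_power G (Suc n)). f (x j)) (x(Suc n := t))) =
        (\<lambda>t\<in>carrier G. f (x j))" if "x \<in> carrier (group_power G n)" for x
      using mem[OF that] False by (intro restrict_ext) simp
    then have "(\<lambda>x\<in>carrier (group_power G n).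
          \<mu> (\<lambda>t\<in>carrier G. (\<lambda>x\<in>carrier (group_power G (Suc n)). f (x j)) (x(Suc n := t)))) =
        (\<lambda>x\<in>carrier (group_power G n). f (x j))"
      by (intro restrict_ext) (simp only: mean_const[OF \<mu>])
    moreover have "mean_power G \<mu> n (\<lambda>x\<in>carrier (group_power G n). f (x j)) = \<mu> f"
      using Suc False by (intro Suc.IH) auto
    ultimately show ?thesis
      by (simp only: mean_power.simps)
  qed
qed

text \<open>The nested restrictions give the average the exact form on which the rules for multiples
  and sums in \<open>RUCB\<close>, and for their means, can be applied.\<close>

lemma coordinate_average_eq:
  "coordinate_average G n f = (\<lambda>x\<in>carrier (group_power G n). (1 / real n) *
     (\<lambda>x\<in>carrier (group_power G n). \<Sum>j\<in>{1..n}. (\<lambda>x\<in>carrier (group_power G n). f (x j)) x) x)"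
  unfolding coordinate_average_def by (intro restrict_ext) simp

lemma coordinate_average_RUCB:
  assumes f: "f \<in> RUCB G T"
  shows "coordinate_average G n f \<in> RUCB (group_power G n) (topology_power T n)"
proof -
  interpret P: topologized_group "group_power G n" "topology_power T n"
    by (rule group_power_topologized)
  show ?thesis
    unfolding coordinate_average_eq
    by (intro P.RUCB_scale P.RUCB_sum coordinate_RUCB f) auto
qed

text \<open>All n marginals contribute \<mu> f. For n = 0 the factor \<open>1 / real n\<close> is 0
  and the average is the zero function.\<close>

lemma mean_power_coordinate_average:
  assumes \<mu>: "\<mu> \<in> means G T" and f: "f \<in> RUCB G T" and n: "n \<ge> 1"
  shows "mean_power G \<mu> n (coordinate_average G n f) = \<mu> f"
proof -
  interpret P: topologized_group "group_power G n" "topology_power T n"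
    by (rule group_power_topologized)
  have "mean_power G \<mu> n (coordinate_average G n f) = (1 / real n) *
      (\<Sum>j\<in>{1..n}. mean_power G \<mu> n (\<lambda>x\<in>carrier (group_power G n). f (x j)))"
    unfolding coordinate_average_eq
    by (subst P.mean_scale[OF mean_power_means[OF \<mu>] P.RUCB_sum], simp, erule coordinate_RUCB[OF f])
      (subst P.mean_sum[OF mean_power_means[OF \<mu>]], auto intro!: coordinate_RUCB[OF f])
  also have "\<dots> = \<mu> f"
    using n mean_power_coordinate[OF \<mu> f] by simp
  finally show ?thesis .
qed

lemma mean_variance_mean_power_ge:
  assumes \<alpha>: "\<alpha> \<in> means G T" and \<beta>: "\<beta> \<in> means G T" and f: "f \<in> RUCB G T" and n: "n \<ge> 1"
  shows "(\<alpha> f - \<beta> f)\<^sup>2 / 4 \<le> mean_variance (group_power G n)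
    (\<lambda>f. (mean_power G \<alpha> n f + mean_power G \<beta> n f) / 2) (coordinate_average G n f)"
proof -
  interpret P: topologized_group "group_power G n" "topology_power T n"
    by (rule group_power_topologized)
  show ?thesis
    using P.mean_variance_average_ge[OF mean_power_means[OF \<alpha>] mean_power_means[OF \<beta>]
        coordinate_average_RUCB[OF f]]
    by (simp only: mean_power_coordinate_average[OF \<alpha> f n] mean_power_coordinate_average[OF \<beta> f n])
qed

end

section \<open>Right-invariant metrics\<close>

sublocale topological_group \<subseteq> topologized_group
  by unfold_locales (rule topspace_eq)

context topological_group
begin

lemma continuous_map_mult:
  assumes "continuous_map X T f" "continuous_map X T h"
  shows "continuous_map X T (\<lambda>x. f x \<otimes> h x)"
  using continuous_map_compose[OF continuous_map_pairedI[OF assms] continuous_mult]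
  by (simp add: o_def)

text \<open>Since g (h x) = (g h g^{-1}) (g x), the modulus of the translate is that of f after
  conjugation by g, and conjugation is continuous and fixes the identity.\<close>

lemma RUCB_left_translate:
  assumes g: "g \<in> carrier G" and f: "f \<in> RUCB G T"
  shows "left_translate G g f \<in> RUCB G T"
proof -
  have conj: "continuous_map T T (\<lambda>x. g \<otimes> x \<otimes> inv g)"
    using g by (intro continuous_map_mult) (auto simp: topspace_eq)
  obtain B where "\<And>x. x \<in> carrier G \<Longrightarrow> \<bar>f x\<bar> \<le> B"
    using RUCB_bound[OF f] by blast
  then show ?thesis
  proof (intro RUCB_I[of _ B])
    fix \<epsilon> :: real
    assume "\<epsilon> > 0"
    from RUCB_unif[OF f this] obtain V where V: "openin T V" "\<one> \<in> V" "V \<subseteq> carrier G"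
      "\<And>g x. g \<in> V \<Longrightarrow> x \<in> carrier G \<Longrightarrow> \<bar>f x - f (g \<otimes> x)\<bar> \<le> \<epsilon>"
      by blast
    let ?W = "{h \<in> topspace T. g \<otimes> h \<otimes> inv g \<in> V}"
    have eq: "g \<otimes> h \<otimes> inv g \<otimes> (g \<otimes> x) = g \<otimes> (h \<otimes> x)" if "h \<in> carrier G" "x \<in> carrier G" for h x
      using that g by (simp add: m_assoc inv_solve_left)
        (metis g inv_closed l_inv l_one m_assoc)
    have "\<bar>f (g \<otimes> x) - f (g \<otimes> (h \<otimes> x))\<bar> \<le> \<epsilon>" if "h \<in> ?W" "x \<in> carrier G" for h x
      using V(4)[of "g \<otimes> h \<otimes> inv g" "g \<otimes> x"] that g eq[of h x] by (simp add: topspace_eq)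
    moreover have "openin T ?W"
      using openin_continuous_map_preimage[OF conj V(1)] .
    ultimately show "\<exists>V. openin T V \<and> \<one> \<in> V \<and> (\<forall>h\<in>V. \<forall>x\<in>carrier G.
        \<bar>left_translate G g f x - left_translate G g f (h \<otimes> x)\<bar> \<le> \<epsilon>)"
      using V(2) g by (intro exI[of _ ?W]) (auto simp: topspace_eq left_translate_def)
  qed (use g in \<open>auto simp: left_translate_def\<close>)
qed

end

locale right_invariant_metric_group = topological_group +
  M: Metric_space "carrier G" d for d +
  assumes right_inv: "right_invariant G d"
    and mtopology_eq: "M.mtopology = T"
begin

lemma dist_right_mult:
  "\<lbrakk>g \<in> carrier G; x \<in> carrier G; y \<in> carrier G\<rbrakk> \<Longrightarrow> d (x \<otimes> g) (y \<otimes> g) = d x y"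
  using right_inv by (simp add: right_invariant_def)

text \<open>This reduces questions about distances between arbitrary points to balls around the
  identity, both for coverings and for comparing two metrics.\<close>

lemma dist_mult_inv:
  assumes "x \<in> carrier G" "y \<in> carrier G"
  shows "d \<one> (x \<otimes> inv y) = d x y"
  using dist_right_mult[of y \<one> "x \<otimes> inv y"] assms by (simp add: m_assoc M.commute)

lemma openin_mball: "openin T (M.mball x r)"
  using M.openin_mball by (simp add: mtopology_eq)

lemma ball_in_open:
  assumes "openin T V" "x \<in> V"
  obtains r where "r > 0" "M.mball x r \<subseteq> V"
  using assms M.openin_mtopology unfolding mtopology_eq by blast

text \<open>Right invariance gives d x (g x) = d 1 g for all x at once. So a small left displacement
  is small uniformly in x, which is the uniformity that \<open>RUCB\<close> asks for.\<close>

lemma Lipschitz_RUCB: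
  assumes ext: "f \<in> extensional (carrier G)"
    and bound: "\<And>x. x \<in> carrier G \<Longrightarrow> \<bar>f x\<bar> \<le> B"
    and lip: "\<And>x y. x \<in> carrier G \<Longrightarrow> y \<in> carrier G \<Longrightarrow> \<bar>f x - f y\<bar> \<le> C * d x y" and "C > 0"
  shows "f \<in> RUCB G T"
proof (rule RUCB_I[OF ext bound])
  fix \<epsilon> :: real
  assume "\<epsilon> > 0"
  have "\<bar>f x - f (g \<otimes> x)\<bar> \<le> \<epsilon>" if g: "g \<in> M.mball \<one> (\<epsilon> / C)" and x: "x \<in> carrier G" for g x
  proof -
    have "d x (g \<otimes> x) = d \<one> g"
      using dist_right_mult[of x \<one> g] g x by simp
    then have "C * d x (g \<otimes> x) \<le> C * (\<epsilon> / C)"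
      using g \<open>C > 0\<close> by (intro mult_left_mono) auto
    then show ?thesis
      using lip[of x "g \<otimes> x"] g x \<open>C > 0\<close> by simp
  qed
  moreover have "\<one> \<in> M.mball \<one> (\<epsilon> / C)"
    using \<open>\<epsilon> > 0\<close> \<open>C > 0\<close> by simp
  ultimately show "\<exists>V. openin T V \<and> \<one> \<in> V \<and> (\<forall>g\<in>V. \<forall>x\<in>carrier G. \<bar>f x - f (g \<otimes> x)\<bar> \<le> \<epsilon>)"
    using openin_mball by blast
qed

section \<open>Separation from non-precompactness and amenability\<close>

text \<open>By right invariance the ball of radius r around y is B y, where B is the r-ball around
  the identity. If B lies in a set U witnessing non-precompactness, a point outside U F lies in no
  such ball with y in F.\<close>

lemma not_precompact_imp_separated:
  assumes "\<not> precompact_group G T"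
  shows "\<exists>r>0. \<forall>F. finite F \<longrightarrow> F \<subseteq> carrier G \<longrightarrow> (\<exists>x\<in>carrier G. \<forall>y\<in>F. r \<le> d x y)"
proof -
  obtain U where U: "neighborhood T \<one> U"
    and no: "\<And>F. finite F \<Longrightarrow> F \<subseteq> carrier G \<Longrightarrow> carrier G \<noteq> U <#> F"
    using assms unfolding precompact_group_def by blast
  then obtain V where V: "openin T V" "\<one> \<in> V" "V \<subseteq> U" and "U \<subseteq> carrier G"
    by (auto simp: neighborhood_def topspace_eq)
  obtain r where r: "r > 0" "M.mball \<one> r \<subseteq> V"
    using ball_in_open[OF V(1,2)] by blast
  have "\<exists>x\<in>carrier G. \<forall>y\<in>F. r \<le> d x y" if F: "finite F" "F \<subseteq> carrier G" for F
  proof -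
    have "U <#> F \<subseteq> carrier G"
      using \<open>U \<subseteq> carrier G\<close> F(2) by (rule set_mult_closed)
    then obtain x where x: "x \<in> carrier G" "x \<notin> U <#> F"
      using no[OF F] by blast
    have "r \<le> d x y" if y: "y \<in> F" for y
    proof (rule ccontr)
      assume "\<not> r \<le> d x y"
      then have "x \<otimes> inv y \<in> M.mball \<one> r"
        using dist_mult_inv[of x y] x(1) y F(2) by (auto simp: subset_iff)
      then have "x \<otimes> inv y \<in> U"
        using r(2) V(3) by blast
      moreover have "x = (x \<otimes> inv y) \<otimes> y"
        using x(1) y F(2) by (auto simp: m_assoc subset_iff)
      ultimately show False
        using x(2) y unfolding set_mult_def by blast
    qed
    with x(1) show ?thesis by blast
  qed
  with r(1) show ?thesis by blast
qed

text \<open>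
  A left-invariant mean vanishes on small balls, since these have arbitrarily many pairwise disjoint
  left translates; if finitely many two-sided translates of a ball covered the group, one right
  translate of it would carry positive mass.
\<close>

lemma two_sided_translates_not_cover:
  assumes \<nu>: "left_invariant_mean G T \<nu>" and "\<not> precompact_group G T"
  shows "\<exists>s>0. \<forall>A C. finite A \<longrightarrow> A \<subseteq> carrier G \<longrightarrow> finite C \<longrightarrow> C \<subseteq> carrier G \<longrightarrow>
    (\<exists>y\<in>carrier G. \<forall>a\<in>A. \<forall>c\<in>C. s \<le> d (a \<otimes> y) c)"
proof -
  obtain r where "r > 0" and sep: "\<forall>F. finite F \<longrightarrow> F \<subseteq> carrier G \<longrightarrow> (\<exists>x\<in>carrier G. \<forall>y\<in>F. r \<le> d x y)"
    using not_precompact_imp_separated[OF assms(2)] by blast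
  \<comment> \<open>The bumps below are supported in balls of radius 2 s. If a y and b y lie in the
    same one, then d a b = d (a y) (b y) < 4 s = r, which is impossible for distinct members of an
    r-separated set.\<close>
  define s where "s = r / 4"
  have "s > 0" using \<open>r > 0\<close> by (simp add: s_def)
  have \<nu>m: "\<nu> \<in> means G T"
    using \<nu> by (simp add: left_invariant_mean_def)
  have separated: "\<exists>F. finite F \<and> card F = N \<and> F \<subseteq> carrier G \<and>
      (\<forall>x\<in>F. \<forall>y\<in>F. x \<noteq> y \<longrightarrow> r \<le> d x y)" for N
  proof (induction N)
    case 0
    show ?case by (rule exI[of _ "{}"]) simp
  next
    case (Suc N)
    then obtain F where "finite F \<and> card F = N \<and> F \<subseteq> carrier G \<and>
        (\<forall>x\<in>F. \<forall>y\<in>F. x \<noteq> y \<longrightarrow> r \<le> d x y)" ..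
    then have F: "finite F" "card F = N" "F \<subseteq> carrier G"
      "\<forall>x\<in>F. \<forall>y\<in>F. x \<noteq> y \<longrightarrow> r \<le> d x y"
      by simp_all
    obtain x where x: "x \<in> carrier G" "\<forall>y\<in>F. r \<le> d x y"
      using sep F(1,3) by blast
    then have "x \<notin> F"
      using \<open>r > 0\<close> by force
    then have "card (insert x F) = Suc N"
      using F(1,2) by simp
    moreover have "\<forall>a\<in>insert x F. \<forall>b\<in>insert x F. a \<noteq> b \<longrightarrow> r \<le> d a b"
      using F(4) x(2) by (auto simp: M.commute)
    ultimately show ?case
      using F(1,3) x(1) by (intro exI[of _ "insert x F"]) simp
  qed
  \<comment> \<open>A Lipschitz substitute for the indicator of a ball around c, so that \<nu> can
    be applied to it: at least 1/2 within radius s, and 0 from radius 2 s on.\<close>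
  define h where "h c = (\<lambda>x\<in>carrier G. max 0 (1 - d x c / (2 * s)))" for c
  have h_eq: "h c x = max 0 (1 - d x c / (2 * s))" if "x \<in> carrier G" for c x
    using that by (simp add: h_def)
  have h_le_1: "h c x \<le> 1" and h_nonneg: "0 \<le> h c x" if "x \<in> carrier G" for c x
    using that \<open>s > 0\<close> by (auto simp: h_eq)
  have h_RUCB: "h c \<in> RUCB G T" if c: "c \<in> carrier G" for c
  proof (rule Lipschitz_RUCB)
    show "h c \<in> extensional (carrier G)" by (simp add: h_def)
    show "\<bar>h c x\<bar> \<le> 1" if "x \<in> carrier G" for x
      using h_le_1[OF that] h_nonneg[OF that] by simp
    show "1 / (2 * s) > 0" using \<open>s > 0\<close> by simp
    fix x y assume xy: "x \<in> carrier G" "y \<in> carrier G"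
    have "\<bar>h c x - h c y\<bar> \<le> \<bar>d x c / (2 * s) - d y c / (2 * s)\<bar>"
      using xy by (simp add: h_eq)
    also have "\<dots> = 1 / (2 * s) * \<bar>d x c - d y c\<bar>"
      using \<open>s > 0\<close> by (simp flip: diff_divide_distrib)
    also have "\<dots> \<le> 1 / (2 * s) * d x y"
      using M.mdist_reverse_triangle[OF xy(1) c xy(2)] M.triangle[OF xy(1) xy(2) c] M.triangle[OF xy(2) xy(1) c]
        \<open>s > 0\<close> by (intro mult_left_mono) (auto simp: M.commute)
    finally show "\<bar>h c x - h c y\<bar> \<le> 1 / (2 * s) * d x y" .
  qed
  have mean_translates: "\<nu> (\<lambda>y\<in>carrier G. \<Sum>a\<in>F. left_translate G a (h c) y) = card F * \<nu> (h c)"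
    if "finite F" "F \<subseteq> carrier G" "c \<in> carrier G" for F c
  proof -
    have "\<nu> (left_translate G a (h c)) = \<nu> (h c)" if "a \<in> F" for a
      using \<nu> h_RUCB \<open>c \<in> carrier G\<close> \<open>F \<subseteq> carrier G\<close> that
      by (auto simp: left_invariant_mean_def)
    then show ?thesis
      using that by (subst mean_sum[OF \<nu>m]) (auto intro!: RUCB_left_translate h_RUCB)
  qed
  have h_null: "\<nu> (h c) \<le> 0" if c: "c \<in> carrier G" for c
  proof (rule ccontr)
    assume "\<not> \<nu> (h c) \<le> 0"
    then obtain N :: nat where N: "1 < N * \<nu> (h c)"
      using reals_Archimedean3 by (metis not_le)
    from separated[of N] obtain F where "finite F \<and> card F = N \<and> F \<subseteq> carrier G \<and>
        (\<forall>x\<in>F. \<forall>y\<in>F. x \<noteq> y \<longrightarrow> r \<le> d x y)" ..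
    then have F: "finite F" "card F = N" "F \<subseteq> carrier G"
      "\<forall>x\<in>F. \<forall>y\<in>F. x \<noteq> y \<longrightarrow> r \<le> d x y"
      by simp_all
    have "\<nu> (\<lambda>y\<in>carrier G. \<Sum>a\<in>F. left_translate G a (h c) y) \<le> 1"
    proof (rule mean_le[OF \<nu>m])
      show "(\<lambda>y\<in>carrier G. \<Sum>a\<in>F. left_translate G a (h c) y) \<in> RUCB G T"
        using F c by (intro RUCB_sum RUCB_left_translate h_RUCB) auto
      fix y assume y: "y \<in> carrier G"
      have "(\<Sum>a\<in>F. h c (a \<otimes> y)) \<le> 1"
      proof (cases "\<exists>a\<in>F. h c (a \<otimes> y) \<noteq> 0")
        case True
        then obtain a where a: "a \<in> F" "h c (a \<otimes> y) \<noteq> 0" by blast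
        have "h c (b \<otimes> y) = 0" if b: "b \<in> F - {a}" for b
        proof (rule ccontr)
          assume "h c (b \<otimes> y) \<noteq> 0"
          then have "d (a \<otimes> y) c < 2 * s" "d (b \<otimes> y) c < 2 * s"
            using a b y F(3) \<open>s > 0\<close> by (auto simp: h_eq subset_iff max_def split: if_splits)
          moreover have "d (a \<otimes> y) (b \<otimes> y) \<le> d (a \<otimes> y) c + d c (b \<otimes> y)"
            using a b y c F(3) by (intro M.triangle) auto
          moreover have "d (a \<otimes> y) (b \<otimes> y) = d a b"
            using a b y F(3) by (intro dist_right_mult) auto
          moreover have "r \<le> d a b"
            using F(4) a b by auto
          ultimately show False
            by (simp add: s_def M.commute)
        qed
        then have "(\<Sum>a\<in>F. h c (a \<otimes> y)) = h c (a \<otimes> y)"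
          using a(1) F(1) by (simp add: sum.remove)
        then show ?thesis
          using h_le_1[of "a \<otimes> y"] a(1) F(3) y by auto
      qed simp
      then show "(\<lambda>y\<in>carrier G. \<Sum>a\<in>F. left_translate G a (h c) y) y \<le> 1"
        using y by (simp add: left_translate_def)
    qed
    then show False
      using mean_translates[OF F(1,3) c] N F(2) by simp
  qed
  have "\<exists>y\<in>carrier G. \<forall>a\<in>A. \<forall>c\<in>C. s \<le> d (a \<otimes> y) c"
    if A: "finite A" "A \<subseteq> carrier G" and C: "finite C" "C \<subseteq> carrier G" for A C
  proof (rule ccontr)
    assume contra: "\<not> ?thesis"
    let ?H = "\<lambda>c. \<lambda>y\<in>carrier G. \<Sum>a\<in>A. left_translate G a (h c) y"
    have H: "?H c \<in> RUCB G T" if "c \<in> C" for c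
      using A C that by (intro RUCB_sum RUCB_left_translate h_RUCB) auto
    have "1 / 2 \<le> \<nu> (\<lambda>y\<in>carrier G. \<Sum>c\<in>C. ?H c y)"
    proof (rule mean_ge[OF \<nu>m RUCB_sum[OF C(1) H]])
      fix y assume y: "y \<in> carrier G"
      obtain a c where a: "a \<in> A" and c: "c \<in> C" and near: "d (a \<otimes> y) c < s"
        using contra y by (meson not_le)
      have nonneg: "0 \<le> h c (a \<otimes> y)" if "a \<in> A" for a c
        using h_nonneg[of "a \<otimes> y"] that A(2) y by auto
      have "1 / 2 \<le> h c (a \<otimes> y)"
        using near \<open>s > 0\<close> a A(2) y by (auto simp: h_eq subset_iff le_max_iff_disj field_simps)
      also have "\<dots> \<le> (\<Sum>a\<in>A. h c (a \<otimes> y))"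
        using nonneg a A(1) by (intro member_le_sum) auto
      also have "\<dots> \<le> (\<Sum>c\<in>C. \<Sum>a\<in>A. h c (a \<otimes> y))"
        using nonneg c C(1) by (intro member_le_sum[of c C "\<lambda>c. \<Sum>a\<in>A. h c (a \<otimes> y)"] sum_nonneg) auto
      also have "\<dots> = (\<lambda>y\<in>carrier G. \<Sum>c\<in>C. ?H c y) y"
        using y by (simp add: left_translate_def)
      finally show "1 / 2 \<le> (\<lambda>y\<in>carrier G. \<Sum>c\<in>C. ?H c y) y" .
    qed
    also have "\<dots> = (\<Sum>c\<in>C. \<nu> (?H c))"
      by (rule mean_sum[OF \<nu>m C(1) H])
    also have "\<dots> = (\<Sum>c\<in>C. card A * \<nu> (h c))"
      using A C by (intro sum.cong refl mean_translates) auto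
    also have "\<dots> \<le> 0"
      using h_null C(2) by (intro sum_nonpos mult_nonneg_nonpos) auto
    finally show False by simp
  qed
  with \<open>s > 0\<close> show ?thesis by blast
qed

lemma separated_sequence_exists:
  fixes q :: "nat \<Rightarrow> 'a"
  assumes "left_invariant_mean G T \<nu>" "\<not> precompact_group G T" and "range q \<subseteq> carrier G"
  obtains w s where "s > 0" "\<forall>k. w k \<in> carrier G"
    "\<forall>i j k l. i \<le> k \<longrightarrow> j \<le> l \<longrightarrow> k \<noteq> l \<longrightarrow> s \<le> d (q i \<otimes> w k) (q j \<otimes> w l)"
proof -
  have q: "q i \<in> carrier G" for i
    using assms(3) by auto
  obtain s where "s > 0" and s: "\<forall>A C. finite A \<longrightarrow> A \<subseteq> carrier G \<longrightarrow>
      finite C \<longrightarrow> C \<subseteq> carrier G \<longrightarrow> (\<exists>y\<in>carrier G. \<forall>a\<in>A. \<forall>c\<in>C. s \<le> d (a \<otimes> y) c)"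
    using two_sided_translates_not_cover[OF assms(1,2)] by blast
  \<comment> \<open>The premise on \<open>w l\<close> makes the choice step solvable for arbitrary
    earlier values. It is discharged once the whole sequence is known to lie in G.\<close>
  have "\<exists>w. \<forall>k. w k \<in> carrier G \<and> (\<forall>l<k. \<forall>i\<le>k. \<forall>j\<le>l. w l \<in> carrier G \<longrightarrow> s \<le> d (q i \<otimes> w k) (q j \<otimes> w l))"
  proof (rule dependent_wellorder_choice)
    fix k and w :: "nat \<Rightarrow> 'a"
    show "\<exists>y. y \<in> carrier G \<and> (\<forall>l<k. \<forall>i\<le>k. \<forall>j\<le>l. w l \<in> carrier G \<longrightarrow> s \<le> d (q i \<otimes> y) (q j \<otimes> w l))"
    proof -
      let ?C = "(\<lambda>(j, l). q j \<otimes> w l) ` {(j, l). l < k \<and> j \<le> l \<and> w l \<in> carrier G}"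
      have "{(j, l). l < k \<and> j \<le> l \<and> w l \<in> carrier G} \<subseteq> {..k} \<times> {..k}" by auto
      then have "finite ?C" by (intro finite_imageI) (rule finite_subset, auto)
      moreover have "?C \<subseteq> carrier G" using q by auto
      ultimately obtain y where "y \<in> carrier G" "\<forall>a\<in>q ` {..k}. \<forall>c\<in>?C. s \<le> d (a \<otimes> y) c"
        using s[rule_format, of "q ` {..k}" ?C] q by blast
      then show ?thesis by (intro exI[of _ y]) auto
    qed
  qed auto
  then obtain w where *: "\<forall>k. w k \<in> carrier G \<and>
      (\<forall>l<k. \<forall>i\<le>k. \<forall>j\<le>l. w l \<in> carrier G \<longrightarrow> s \<le> d (q i \<otimes> w k) (q j \<otimes> w l))"
    ..
  then have w: "w k \<in> carrier G" for k
    by simp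
  have **: "s \<le> d (q i \<otimes> w k) (q j \<otimes> w l)" if "l < k" "i \<le> k" "j \<le> l" for k l i j
    using * that by simp
  have "\<forall>i j k l. i \<le> k \<longrightarrow> j \<le> l \<longrightarrow> k \<noteq> l \<longrightarrow> s \<le> d (q i \<otimes> w k) (q j \<otimes> w l)"
  proof (intro allI impI)
    fix i j k l :: nat assume "i \<le> k" "j \<le> l" "k \<noteq> l"
    then show "s \<le> d (q i \<otimes> w k) (q j \<otimes> w l)"
      using **[of l k i j] **[of k l j i] by (cases "k < l") (auto simp: M.commute)
  qed
  with that[OF \<open>s > 0\<close>] w show thesis by blast
qed

section \<open>Two distinct invariant means, uniformly over all metrics\<close>

text \<open>The function is the distance to \<open>E\<close> cut off at 1. The cutoff keeps the
  Lipschitz constant and is the reason for \<open>min 1 \<delta>\<close>.\<close>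

lemma separating_function_exists:
  assumes "E \<subseteq> carrier G" "E \<noteq> {}"
  obtains f where "f \<in> extensional (carrier G)" "f \<in> carrier G \<rightarrow> {0..1}"
    "\<forall>x\<in>carrier G. \<forall>y\<in>carrier G. \<bar>f x - f y\<bar> \<le> d x y"
    "\<forall>x\<in>E. f x = 0"
    "\<forall>x\<in>carrier G. \<forall>\<delta>. (\<forall>y\<in>E. \<delta> \<le> d x y) \<longrightarrow> min 1 \<delta> \<le> f x"
proof -
  define D where "D x = (INF y\<in>E. d x y)" for x
  have bdd: "bdd_below (d x ` E)" for x
    using M.nonneg by (intro bdd_belowI2)
  have D_nonneg: "0 \<le> D x" for x
    unfolding D_def using assms(2) by (intro cINF_greatest) auto
  have D_le: "D x \<le> D y + d x y" if "x \<in> carrier G" "y \<in> carrier G" for x y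
  proof -
    have "D x - d x y \<le> D y"
      unfolding D_def[of y]
    proof (rule cINF_greatest[OF assms(2)])
      fix z assume z: "z \<in> E"
      have "D x \<le> d x z"
        unfolding D_def using bdd z by (intro cINF_lower)
      also have "\<dots> \<le> d x y + d y z"
        using that z assms(1) by (intro M.triangle) auto
      finally show "D x - d x y \<le> d y z" by simp
    qed
    then show ?thesis by simp
  qed
  show thesis
  proof
    let ?f = "\<lambda>x\<in>carrier G. min 1 (D x)"
    show "?f \<in> extensional (carrier G)" by simp
    show "?f \<in> carrier G \<rightarrow> {0..1}" using D_nonneg by auto
    show "\<forall>x\<in>carrier G. \<forall>y\<in>carrier G. \<bar>?f x - ?f y\<bar> \<le> d x y"
    proof (intro ballI)
      fix x y assume "x \<in> carrier G" "y \<in> carrier G"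
      then show "\<bar>?f x - ?f y\<bar> \<le> d x y"
        using D_le[of x y] D_le[of y x] by (simp add: M.commute[of y x])
    qed
    show "\<forall>x\<in>E. ?f x = 0"
    proof
      fix x assume x: "x \<in> E"
      have "D x \<le> d x x"
        unfolding D_def using bdd x by (intro cINF_lower)
      then show "?f x = 0"
        using x assms(1) D_nonneg[of x] by auto
    qed
    show "\<forall>x\<in>carrier G. \<forall>\<delta>. (\<forall>y\<in>E. \<delta> \<le> d x y) \<longrightarrow> min 1 \<delta> \<le> ?f x"
    proof (intro ballI allI impI)
      fix x \<delta> assume x: "x \<in> carrier G" and le: "\<forall>y\<in>E. \<delta> \<le> d x y"
      have "\<delta> \<le> D x"
        unfolding D_def using le assms(2) by (intro cINF_greatest) auto
      then show "min 1 \<delta> \<le> ?f x" using x by simp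
    qed
  qed
qed

text \<open>Both distances depend only on x y^{-1}, so it suffices to fit a ball of d' into a ball
  of d at the identity, which equality of the topologies permits.\<close>

lemma uniformly_finer:
  assumes "right_invariant_metric_group G T d'" "s > 0"
  obtains s' where "s' > 0" "\<forall>x\<in>carrier G. \<forall>y\<in>carrier G. s \<le> d x y \<longrightarrow> s' \<le> d' x y"
proof -
  interpret M': right_invariant_metric_group G T d' by fact
  obtain s' where "s' > 0" and sub: "M'.M.mball \<one> s' \<subseteq> M.mball \<one> s"
    using M'.ball_in_open[OF openin_mball[of \<one> s]] \<open>s > 0\<close> by (metis M.centre_in_mball_iff one_closed)
  have "s' \<le> d' x y" if "x \<in> carrier G" "y \<in> carrier G" "s \<le> d x y" for x y
  proof (rule ccontr)
    assume "\<not> s' \<le> d' x y"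
    then have "x \<otimes> inv y \<in> M'.M.mball \<one> s'"
      using M'.dist_mult_inv[OF that(1,2)] that by auto
    then have "x \<otimes> inv y \<in> M.mball \<one> s" using sub by blast
    then show False
      using dist_mult_inv[OF that(1,2)] that by auto
  qed
  with \<open>s' > 0\<close> that show thesis by simp
qed

lemma distinct_invariant_means:
  assumes \<nu>: "left_invariant_mean G T \<nu>" and "\<not> precompact_group G T" and "second_countable T"
  obtains \<alpha> \<beta> where "left_invariant_mean G T \<alpha>" "left_invariant_mean G T \<beta>"
    "\<forall>d'. right_invariant_metric_group G T d' \<longrightarrow>
       (\<exists>f\<in>RUCB G T. f \<in> carrier G \<rightarrow> {0..1} \<and>
         (\<forall>x\<in>carrier G. \<forall>y\<in>carrier G. \<bar>f x - f y\<bar> \<le> d' x y) \<and> \<alpha> f < \<beta> f)"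
proof -
  obtain Q where Q: "countable Q" "Q \<subseteq> carrier G" "T closure_of Q = carrier G"
    using second_countable_imp_separable_space[OF assms(3)]
    by (auto simp: separable_space_def topspace_eq)
  have dense: "U \<inter> Q \<noteq> {}" if U: "openin T U" "U \<noteq> {}" for U
  proof -
    obtain x where "x \<in> U" using U(2) by blast
    then have "x \<in> T closure_of Q"
      using openin_subset[OF U(1)] Q(3) by (auto simp: topspace_eq)
    then show ?thesis
      using U(1) \<open>x \<in> U\<close> by (auto simp: in_closure_of)
  qed
  have "Q \<noteq> {}"
    using dense[OF openin_topspace] one_closed by (auto simp: topspace_eq)
  define q where "q = from_nat_into Q"
  have range_q: "range q = Q"
    using \<open>Q \<noteq> {}\<close> Q(1) by (simp add: q_def range_from_nat_into)
  then have range_q_sub: "range q \<subseteq> carrier G"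
    using Q(2) by simp
  then have q: "q i \<in> carrier G" for i
    by auto
  obtain w s where "s > 0" and "\<forall>k. w k \<in> carrier G"
    and "\<forall>i j k l. i \<le> k \<longrightarrow> j \<le> l \<longrightarrow> k \<noteq> l \<longrightarrow> s \<le> d (q i \<otimes> w k) (q j \<otimes> w l)"
    by (rule separated_sequence_exists[OF assms(1,2) range_q_sub])
  then have w: "w k \<in> carrier G"
    and sep: "i \<le> k \<Longrightarrow> j \<le> l \<Longrightarrow> k \<noteq> l \<Longrightarrow> s \<le> d (q i \<otimes> w k) (q j \<otimes> w l)" for i j k l
    by simp_all
  have transl: "continuous_map T T (\<lambda>g. g \<otimes> x)" if "x \<in> carrier G" for x
    using that by (intro continuous_map_mult) (auto simp: topspace_eq)
  obtain \<alpha> where \<alpha>: "left_invariant_mean G T \<alpha>"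
    "\<forall>f\<in>RUCB G T. \<forall>c. (\<forall>x\<in>Q. eventually (\<lambda>k. c \<le> f (x \<otimes> w (2 * k))) sequentially) \<longrightarrow> c \<le> \<alpha> f"
    by (rule limit_mean_exists[OF \<nu>, of "\<lambda>k. w (2 * k)", OF w Q(2) dense transl])
  obtain \<beta> where \<beta>: "left_invariant_mean G T \<beta>"
    "\<forall>f\<in>RUCB G T. \<forall>c. (\<forall>x\<in>Q. eventually (\<lambda>k. c \<le> f (x \<otimes> w (Suc (2 * k)))) sequentially) \<longrightarrow> c \<le> \<beta> f"
    by (rule limit_mean_exists[OF \<nu>, of "\<lambda>k. w (Suc (2 * k))", OF w Q(2) dense transl])
  \<comment> \<open>\<open>E\<close> contains the points \<open>q i \<otimes> w (2 * k)\<close> for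
    each i and all large k. The bound on i keeps it at d-distance at least s from the points
    \<open>q i \<otimes> w (Suc (2 * k))\<close> with k \<ge> i.\<close>
  define E where "E = {q i \<otimes> w (2 * k) | i k. i \<le> 2 * k}"
  have E: "E \<subseteq> carrier G" "E \<noteq> {}"
    using q w by (auto simp: E_def)
  have "\<exists>f\<in>RUCB G T. f \<in> carrier G \<rightarrow> {0..1} \<and>
      (\<forall>x\<in>carrier G. \<forall>y\<in>carrier G. \<bar>f x - f y\<bar> \<le> d' x y) \<and> \<alpha> f < \<beta> f"
    if d': "right_invariant_metric_group G T d'" for d'
  proof -
    interpret M': right_invariant_metric_group G T d' by fact
    obtain s' where "s' > 0"
      and s': "\<forall>x\<in>carrier G. \<forall>y\<in>carrier G. s \<le> d x y \<longrightarrow> s' \<le> d' x y"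
      by (rule uniformly_finer[OF d' \<open>s > 0\<close>])
    obtain f where ext: "f \<in> extensional (carrier G)" and f01: "f \<in> carrier G \<rightarrow> {0..1}"
      and lip: "\<forall>x\<in>carrier G. \<forall>y\<in>carrier G. \<bar>f x - f y\<bar> \<le> d' x y"
      and f0: "\<forall>x\<in>E. f x = 0"
      and f1: "\<forall>x\<in>carrier G. \<forall>\<delta>. (\<forall>y\<in>E. \<delta> \<le> d' x y) \<longrightarrow> min 1 \<delta> \<le> f x"
      by (rule M'.separating_function_exists[OF E])
    have f: "f \<in> RUCB G T"
    proof (rule M'.Lipschitz_RUCB[OF ext])
      show "\<bar>f x\<bar> \<le> 1" if "x \<in> carrier G" for x
        using funcset_mem[OF f01 that] by simp
      show "\<bar>f x - f y\<bar> \<le> 1 * d' x y" if "x \<in> carrier G" "y \<in> carrier G" for x y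
        using lip that by simp
    qed simp
    \<comment> \<open>Limit means are controlled from below only, so the upper bound on \<alpha> f
      is obtained by passing to -f.\<close>
    have "0 \<le> \<alpha> (\<lambda>x\<in>carrier G. (-1) * f x)"
    proof (rule \<alpha>(2)[rule_format, OF RUCB_scale[OF f]])
      fix x assume "x \<in> Q"
      then obtain i where i: "x = q i" using range_q by auto
      have "f (x \<otimes> w (2 * k)) = 0" if "k \<ge> i" for k
      proof (rule f0[rule_format])
        have "i \<le> 2 * k" using that by simp
        then show "x \<otimes> w (2 * k) \<in> E" unfolding E_def i by blast
      qed
      then show "\<forall>\<^sub>F k in sequentially. 0 \<le> (\<lambda>x\<in>carrier G. (-1) * f x) (x \<otimes> w (2 * k))"
        using q w i by (intro eventually_sequentiallyI[of i]) simp
    qed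
    then have "\<alpha> f \<le> 0"
      using mean_scale[OF _ f, of \<alpha> "-1"] \<alpha>(1) by (simp add: left_invariant_mean_def)
    have "min 1 s' \<le> \<beta> f"
    proof (rule \<beta>(2)[rule_format, OF f])
      fix x assume "x \<in> Q"
      then obtain i where i: "x = q i" using range_q by auto
      have "min 1 s' \<le> f (x \<otimes> w (Suc (2 * k)))" if k: "k \<ge> i" for k
      proof (rule f1[rule_format])
        show "x \<otimes> w (Suc (2 * k)) \<in> carrier G" using i q w by simp
        fix y assume "y \<in> E"
        then obtain j l where y: "y = q j \<otimes> w (2 * l)" "j \<le> 2 * l"
          by (auto simp: E_def)
        have "Suc (2 * k) \<noteq> 2 * l" by presburger
        then have "s \<le> d (x \<otimes> w (Suc (2 * k))) y"
          unfolding i y(1) using k y(2) by (intro sep) auto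
        then show "s' \<le> d' (x \<otimes> w (Suc (2 * k))) y"
          using i y(1) q w by (intro s'[rule_format]) auto
      qed
      then show "\<forall>\<^sub>F k in sequentially. min 1 s' \<le> f (x \<otimes> w (Suc (2 * k)))"
        by (intro eventually_sequentiallyI[of i])
    qed
    then have "0 < \<beta> f" using \<open>s' > 0\<close> by linarith
    with \<open>\<alpha> f \<le> 0\<close> have "\<alpha> f < \<beta> f" by linarith
    then show ?thesis
      using f f01 lip by blast
  qed
  with that[OF \<alpha>(1) \<beta>(1)] show thesis by simp
qed

end

section \<open>Mixing the iterated means\<close>

theorem corollary5p5:
  fixes G :: "('a, 'b) monoid_scheme" and T :: "'a topology"
  assumes "topological_group G T"
    and "second_countable T"
    and "\<not> precompact_group G T"
    and "amenable_group G T"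
  shows "\<exists>\<mu> :: nat \<Rightarrow> ((nat \<Rightarrow> 'a) \<Rightarrow> real) \<Rightarrow> real.
    (\<forall>n\<ge>1. left_invariant_mean (group_power G n) (topology_power T n) (\<mu> n)) \<and>
    (\<forall>d. Metric_space (carrier G) d \<and> right_invariant G d \<and>
         Metric_space.mtopology (carrier G) d = T \<longrightarrow>
       (\<exists>f. f \<in> carrier G \<rightarrow> {0..1} \<and>
          (\<forall>x\<in>carrier G. \<forall>y\<in>carrier G. \<bar>f x - f y\<bar> \<le> d x y) \<and>
          (INF n\<in>{1..}. mean_variance (group_power G n) (\<mu> n) (coordinate_average G n f)) > 0))"
proof -
  interpret topological_group G T by fact
  obtain \<nu> where \<nu>: "left_invariant_mean G T \<nu>"
    using assms(4) unfolding amenable_group_def by blast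
  have metric_iff: "Metric_space (carrier G) d \<and> right_invariant G d \<and>
      Metric_space.mtopology (carrier G) d = T \<longleftrightarrow> right_invariant_metric_group G T d" for d
    using assms(1) by (auto simp: right_invariant_metric_group_def right_invariant_metric_group_axioms_def)
  show ?thesis
  proof (cases "\<exists>d. right_invariant_metric_group G T d")
    \<comment> \<open>This can happen, as T is not assumed to be Hausdorff. The claim about metrics
      is then vacuous, but invariant means on all powers still have to be supplied.\<close>
    case False
    then show ?thesis
      unfolding metric_iff using mean_power_left_invariant[OF \<nu>]
      by (intro exI[of _ "mean_power G \<nu>"]) blast
  next
    case True
    \<comment> \<open>Any one compatible metric serves to construct \<alpha> and \<beta>. The metric
      of the statement is chosen afterwards and affects only f.\<close>
    then obtain d0 where "right_invariant_metric_group G T d0" by blast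
    then interpret right_invariant_metric_group G T d0 .
    obtain \<alpha> \<beta> where \<alpha>: "left_invariant_mean G T \<alpha>" and \<beta>: "left_invariant_mean G T \<beta>"
      and distinct: "\<forall>d. right_invariant_metric_group G T d \<longrightarrow>
        (\<exists>f\<in>RUCB G T. f \<in> carrier G \<rightarrow> {0..1} \<and>
          (\<forall>x\<in>carrier G. \<forall>y\<in>carrier G. \<bar>f x - f y\<bar> \<le> d x y) \<and> \<alpha> f < \<beta> f)"
      by (rule distinct_invariant_means[OF \<nu> assms(3,2)])
    define \<mu> where "\<mu> n f = (mean_power G \<alpha> n f + mean_power G \<beta> n f) / 2" for n f
    have inv_mean: "left_invariant_mean (group_power G n) (topology_power T n) (\<mu> n)" for n
      unfolding \<mu>_def
      by (intro topologized_group.left_invariant_mean_average group_power_topologized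
          mean_power_left_invariant \<alpha> \<beta>)
    have "\<exists>f. f \<in> carrier G \<rightarrow> {0..1} \<and>
        (\<forall>x\<in>carrier G. \<forall>y\<in>carrier G. \<bar>f x - f y\<bar> \<le> d x y) \<and>
        (INF n\<in>{1..}. mean_variance (group_power G n) (\<mu> n) (coordinate_average G n f)) > 0"
      if d: "right_invariant_metric_group G T d" for d
    proof -
      obtain f where f: "f \<in> RUCB G T" "f \<in> carrier G \<rightarrow> {0..1}"
        "\<forall>x\<in>carrier G. \<forall>y\<in>carrier G. \<bar>f x - f y\<bar> \<le> d x y" and "\<alpha> f < \<beta> f"
        using distinct d by blast
      have "0 < (\<alpha> f - \<beta> f)\<^sup>2 / 4"
        using \<open>\<alpha> f < \<beta> f\<close> by simp
      also have "\<dots> \<le> (INF n\<in>{1..}. mean_variance (group_power G n) (\<mu> n) (coordinate_average G n f))"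
      proof (rule cINF_greatest)
        fix n :: nat assume "n \<in> {1..}"
        then show "(\<alpha> f - \<beta> f)\<^sup>2 / 4 \<le> mean_variance (group_power G n) (\<mu> n) (coordinate_average G n f)"
          unfolding \<mu>_def using \<alpha> \<beta> f(1)
          by (intro mean_variance_mean_power_ge) (auto simp: left_invariant_mean_def)
      qed simp
      finally show ?thesis
        using f(2,3) by blast
    qed
    then show ?thesis
      unfolding metric_iff using inv_mean by blast
  qed
qed

end
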